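(* Let $\gamma\in(0,1)$ be a d.c.e. real. Then the following are equivalent. (i) $\gamma$ is strongly d.c.e. $0$-speedable. (ii) $\gamma$ is d.c.e. speedable. (iii) $\gamma$ is weakly d.c.e. speedable. (iv) $\gamma$ is not Martin-Löf random.
   Context: Conventions: "real" means a real number in the open interval $(0,1)$. An approximation of a real $\alpha$ is a sequence $\{a_s\}_{s\in\omega}$ of rational numbers in $[0,1]$ converging to $\alpha$. It is computable if $a_s$ can be computed from $s$. A d.c.e. approximation is a computable approximation of bounded variation, i.e. $\sum_{s}|a_s-a_{s+1}|<\infty$. A real is d.c.e. if it has a d.c.e. approximation. A computable order is a computable function $f:\mathbb N\to\mathbb N$ that is nondecreasing and unbounded. Speedability of approximations: let $\{a_s\}_{s\in\omega}$ be a computable approximation of $\alpha$, let $\rho\in[0,1)$ be rational, and let $f$ be a computable order. The approximation is $\rho$-speedable via $f$ if either $\alpha$ is rational, or $\alpha$ is irrational and $$\liminf_{s\to\infty}\left|\frac{\alpha-a_{f(s)}}{\alpha-a_s}\right|\le\rho .$$ It is $\rho$-speedable if it is $\rho$-speedable via some computable order $f$, and speedable if it is $\rho$-speedable for some $\rho\in[0,1)$. Speedability of reals: a real $\alpha$ is - d.c.e. speedable if it has a d.c.e. approximation that is speedable; - strongly d.c.e. $0$-speedable if it has a d.c.e. approximation that is $0$-speedable via the function $s\mapsto s+1$; - weakly d.c.e. speedable if there exist a rational $\rho\in(0,1)$ and two d.c.e. approximations $\{a_s\}_{s\in\omega}$ and $\{b_s\}_{s\in\omega}$ of $\alpha$ such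 that $\liminf_{s\to\infty}\left|\frac{\alpha-b_s}{\alpha-a_s}\right|\le\rho$. Randomness: reals are identified with infinite binary sequences via binary expansion (for dyadic rationals, the expansion ending in infinitely many zeros). For a set $E$ of finite binary strings, let $[\![E]\!]$ be the set of infinite binary sequences extending some string in $E$, and let $\mu$ be Lebesgue measure. A Martin-Löf test is a uniformly computable sequence $\{U_i\}_{i\in\omega}$ of prefix-free sets of finite binary strings with $\mu([\![U_i]\!])\le 2^{-i}$ for all $i$. A real $\gamma$ is (Martin-Löf) random if there is no Martin-Löf test with $\gamma\in\bigcap_i[\![U_i]\!]$. *)

theory Defs
  imports "HOL-Probability.Probability" "HOL-Library.Sublist"
begin

text \<open>Total recursive functions. The first argument is the arity; only the values on lists of
  that length matter. Minimisation is restricted to functions that have a zero for every choice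
  of the parameters, so that every function in the class is total.\<close>

inductive recursive_fn :: "nat \<Rightarrow> (nat list \<Rightarrow> nat) \<Rightarrow> bool" where
  zero: "recursive_fn n (\<lambda>xs. 0)"
| succ: "recursive_fn 1 (\<lambda>xs. Suc (hd xs))"
| proj: "i < n \<Longrightarrow> recursive_fn n (\<lambda>xs. xs ! i)"
| comp: "recursive_fn (length gs) f \<Longrightarrow> (\<And>g. g \<in> set gs \<Longrightarrow> recursive_fn n g) \<Longrightarrow>
    recursive_fn n (\<lambda>xs. f (map (\<lambda>g. g xs) gs))"
| prim_rec: "recursive_fn n f \<Longrightarrow> recursive_fn (Suc (Suc n)) g \<Longrightarrow>
    recursive_fn (Suc n)
      (\<lambda>xs. rec_nat (f (tl xs)) (\<lambda>k r. g (k # r # tl xs)) (hd xs))"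
| minim: "recursive_fn (Suc n) f \<Longrightarrow> (\<And>xs. length xs = n \<Longrightarrow> \<exists>k. f (k # xs) = 0) \<Longrightarrow>
    recursive_fn n (\<lambda>xs. LEAST k. f (k # xs) = 0)"

definition computable :: "(nat \<Rightarrow> nat) \<Rightarrow> bool" where
  "computable f \<longleftrightarrow> (\<exists>g. recursive_fn 1 g \<and> (\<forall>x. g [x] = f x))"

definition computable_rat_seq :: "(nat \<Rightarrow> rat) \<Rightarrow> bool" where
  "computable_rat_seq a \<longleftrightarrow> (\<exists>p q r. computable p \<and> computable q \<and> computable r \<and>
     (\<forall>s. r s > 0 \<and> a s = (of_nat (p s) - of_nat (q s)) / of_nat (r s)))"

definition computable_order :: "(nat \<Rightarrow> nat) \<Rightarrow> bool" where
  "computable_order f \<longleftrightarrow> computable f \<and> mono f \<and> (\<forall>n. \<exists>s. n \<le> f s)"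

definition approximation :: "(nat \<Rightarrow> rat) \<Rightarrow> real \<Rightarrow> bool" where
  "approximation a \<alpha> \<longleftrightarrow>
     (\<forall>s. 0 \<le> a s \<and> a s \<le> 1) \<and> (\<lambda>s. real_of_rat (a s)) \<longlonglongrightarrow> \<alpha>"

definition dce_approximation :: "(nat \<Rightarrow> rat) \<Rightarrow> real \<Rightarrow> bool" where
  "dce_approximation a \<alpha> \<longleftrightarrow> approximation a \<alpha> \<and> computable_rat_seq a \<and>
     summable (\<lambda>s. \<bar>real_of_rat (a s) - real_of_rat (a (Suc s))\<bar>)"

definition dce_real :: "real \<Rightarrow> bool" where
  "dce_real \<alpha> \<longleftrightarrow> (\<exists>a. dce_approximation a \<alpha>)"

text \<open>The limit inferior is taken in the extended reals because the quotients may tend to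
  infinity.\<close>

definition speedable_via :: "rat \<Rightarrow> (nat \<Rightarrow> nat) \<Rightarrow> (nat \<Rightarrow> rat) \<Rightarrow> real \<Rightarrow> bool" where
  "speedable_via \<rho> f a \<alpha> \<longleftrightarrow> \<alpha> \<in> \<rat> \<or>
     (\<alpha> \<notin> \<rat> \<and>
      liminf (\<lambda>s. ereal \<bar>(\<alpha> - real_of_rat (a (f s))) / (\<alpha> - real_of_rat (a s))\<bar>)
        \<le> ereal (real_of_rat \<rho>))"

definition rho_speedable :: "rat \<Rightarrow> (nat \<Rightarrow> rat) \<Rightarrow> real \<Rightarrow> bool" where
  "rho_speedable \<rho> a \<alpha> \<longleftrightarrow> (\<exists>f. computable_order f \<and> speedable_via \<rho> f a \<alpha>)"

definition speedable :: "(nat \<Rightarrow> rat) \<Rightarrow> real \<Rightarrow> bool" where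
  "speedable a \<alpha> \<longleftrightarrow> (\<exists>\<rho>. 0 \<le> \<rho> \<and> \<rho> < 1 \<and> rho_speedable \<rho> a \<alpha>)"

definition dce_speedable :: "real \<Rightarrow> bool" where
  "dce_speedable \<alpha> \<longleftrightarrow> (\<exists>a. dce_approximation a \<alpha> \<and> speedable a \<alpha>)"

definition strongly_dce_0_speedable :: "real \<Rightarrow> bool" where
  "strongly_dce_0_speedable \<alpha> \<longleftrightarrow>
     (\<exists>a. dce_approximation a \<alpha> \<and> speedable_via 0 (\<lambda>s. s + 1) a \<alpha>)"

text \<open>The quotient below has a zero denominator only if \<open>\<alpha>\<close> is rational. The resulting
  convention \<open>x / 0 = 0\<close> does not matter: every rational \<open>\<alpha>\<close> in the open unit interval
  satisfies the definition with all denominators nonzero.\<close>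

definition weakly_dce_speedable :: "real \<Rightarrow> bool" where
  "weakly_dce_speedable \<alpha> \<longleftrightarrow>
     (\<exists>\<rho>::rat. 0 < \<rho> \<and> \<rho> < 1 \<and>
       (\<exists>a b. dce_approximation a \<alpha> \<and> dce_approximation b \<alpha> \<and>
         liminf (\<lambda>s. ereal \<bar>(\<alpha> - real_of_rat (b s)) / (\<alpha> - real_of_rat (a s))\<bar>)
           \<le> ereal (real_of_rat \<rho>)))"

text \<open>Digit \<open>n\<close> after the binary point, for \<open>\<alpha>\<close> in \<open>[0,1)\<close>; dyadic rationals get the
  expansion ending in zeros.\<close>

definition binary_expansion :: "real \<Rightarrow> nat \<Rightarrow> bool" where
  "binary_expansion \<alpha> n \<longleftrightarrow> odd \<lfloor>\<alpha> * 2 ^ Suc n\<rfloor>"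

definition cylinders :: "bool list set \<Rightarrow> (nat \<Rightarrow> bool) set" where
  "cylinders E = {X. \<exists>\<sigma>\<in>E. \<forall>i < length \<sigma>. X i = \<sigma> ! i}"

text \<open>Lebesgue measure on infinite binary sequences, i.e. the fair-coin product measure.\<close>

definition cantor_measure :: "(nat \<Rightarrow> bool) measure" where
  "cantor_measure = PiM UNIV (\<lambda>_. measure_pmf (bernoulli_pmf (1 / 2)))"

definition prefix_free :: "bool list set \<Rightarrow> bool" where
  "prefix_free E \<longleftrightarrow> (\<forall>\<sigma>\<in>E. \<forall>\<tau>\<in>E. prefix \<sigma> \<tau> \<longrightarrow> \<sigma> = \<tau>)"

text \<open>The number with binary numeral \<open>1\<sigma>\<close>, most significant digit first; this is a bijection
  between binary strings and positive numbers.\<close>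

definition string_code :: "bool list \<Rightarrow> nat" where
  "string_code \<sigma> = horner_sum of_bool 2 (rev (True # \<sigma>))"

definition uniformly_computable :: "(nat \<Rightarrow> bool list set) \<Rightarrow> bool" where
  "uniformly_computable U \<longleftrightarrow>
     (\<exists>g. recursive_fn 2 g \<and> (\<forall>i \<sigma>. g [i, string_code \<sigma>] = of_bool (\<sigma> \<in> U i)))"

definition martin_loef_test :: "(nat \<Rightarrow> bool list set) \<Rightarrow> bool" where
  "martin_loef_test U \<longleftrightarrow> uniformly_computable U \<and>
     (\<forall>i. prefix_free (U i) \<and> emeasure cantor_measure (cylinders (U i)) \<le> ennreal ((1 / 2) ^ i))"

definition martin_loef_random :: "real \<Rightarrow> bool" where
  "martin_loef_random \<gamma> \<longleftrightarrow>
     \<not> (\<exists>U. martin_loef_test U \<and> binary_expansion \<gamma> \<in> (\<Inter>i. cylinders (U i)))"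

end

theory Submission
  imports Defs
begin

text \<open>If \<open>l\<close> and \<open>r\<close> are computable sequences of rationals with \<open>\<Sum>\<bar>l s - r s\<bar>\<close> finite and \<open>x\<close> lies
  between \<open>l s\<close> and \<open>r s\<close> infinitely often, then \<open>x\<close> is not random: the strings contained in many of
  these intervals form a test. In particular a random real is eventually on one side of each of its
  d.c.e. approximations. Suppose \<open>a\<close> and \<open>b\<close> witness that \<open>x\<close> is weakly d.c.e. speedable. Then \<open>a s\<close>
  and \<open>r s = a s + C * (b s - a s)\<close>, for a suitable constant \<open>C\<close>, lie on opposite sides of \<open>x\<close>
  infinitely often. For random \<open>x\<close> this must then happen for all large \<open>s\<close>, so \<open>x\<close> is computable,
  a contradiction.

  Conversely, let a test capture \<open>x\<close>. Follow a given d.c.e. approximation, and when it first enters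
  the interval of a test string make a detour to a point far away relative to the length of the
  interval and come back. The weights are chosen such that the detours have finite total length.
  Returning from a detour caused by an interval around \<open>x\<close> is an arbitrarily large relative gain in
  a single step.\<close>

section \<open>Closure properties of total recursive functions\<close>

text \<open>The list is an environment whose \<open>i\<close>-th variable is written with \<open>i\<close> calls of \<^const>\<open>tl\<close> under
  \<^const>\<open>hd\<close>, so that rules with a bound variable, which extend the environment by a new head,
  apply by higher-order pattern unification.\<close>

definition computable_on :: "nat \<Rightarrow> (nat list \<Rightarrow> nat) \<Rightarrow> bool" where
  "computable_on n f \<longleftrightarrow> (\<exists>g. recursive_fn n g \<and> (\<forall>xs. length xs = n \<longrightarrow> g xs = f xs))"

definition decidable_on :: "nat \<Rightarrow> (nat list \<Rightarrow> bool) \<Rightarrow> bool" where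
  "decidable_on n P \<longleftrightarrow> computable_on n (\<lambda>xs. of_bool (P xs))"

lemma recursive_imp_computable_on: "recursive_fn n f \<Longrightarrow> computable_on n f"
  unfolding computable_on_def by blast

lemma computable_on_cong:
  assumes "computable_on n f" "\<And>xs. length xs = n \<Longrightarrow> f xs = g xs"
  shows "computable_on n g"
  using assms unfolding computable_on_def by metis

lemma computable_on_compose:
  assumes f: "computable_on (length gs) f" and gs: "\<And>g. g \<in> set gs \<Longrightarrow> computable_on n g"
  shows "computable_on n (\<lambda>xs. f (map (\<lambda>g. g xs) gs))"
proof -
  obtain f' where f': "recursive_fn (length gs) f'" "\<And>xs. length xs = length gs \<Longrightarrow> f' xs = f xs"
    using f unfolding computable_on_def by blast
  obtain h where h: "\<And>g. g \<in> set gs \<Longrightarrow> recursive_fn n (h g)"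
    "\<And>g xs. g \<in> set gs \<Longrightarrow> length xs = n \<Longrightarrow> h g xs = g xs"
    using gs unfolding computable_on_def by metis
  have "recursive_fn n (\<lambda>xs. f' (map (\<lambda>g. g xs) (map h gs)))"
    by (rule recursive_fn.comp) (use f' h in auto)
  moreover have "f' (map (\<lambda>g. g xs) (map h gs)) = f (map (\<lambda>g. g xs) gs)" if "length xs = n" for xs
    using that by (subst f'(2)) (auto intro!: arg_cong[where f = f] simp: h)
  ultimately show ?thesis
    unfolding computable_on_def by blast
qed

lemma computable_on_compose_1:
  assumes "computable_on 1 f" "computable_on n g"
  shows "computable_on n (\<lambda>xs. f [g xs])"
  using computable_on_compose[of "[g]" f n] assms by simp

lemma computable_on_compose_2:
  assumes "computable_on 2 f" "computable_on n g" "computable_on n h"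
  shows "computable_on n (\<lambda>xs. f [g xs, h xs])"
  using computable_on_compose[of "[g, h]" f n] assms by (auto simp: numeral_2_eq_2)

lemma computable_on_nth: "i < n \<Longrightarrow> computable_on n (\<lambda>xs. xs ! i)"
  by (intro recursive_imp_computable_on recursive_fn.proj)

text \<open>Primitive recursion runs on the head of its argument list. This rule pushes a computed
  bound there, passing the old environment on by projections.\<close>

lemma computable_on_compose_Cons:
  assumes f: "computable_on (Suc n) f" and g: "computable_on n g"
  shows "computable_on n (\<lambda>xs. f (g xs # xs))"
proof -
  let ?gs = "g # map (\<lambda>i xs. xs ! i) [0..<n]"
  have "computable_on n (\<lambda>xs. f (map (\<lambda>g. g xs) ?gs))"
    by (rule computable_on_compose) (use f g computable_on_nth in auto)
  moreover have "map (\<lambda>g. g xs) ?gs = g xs # xs" if "length xs = n" for xs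
    using that by (simp add: comp_def) (metis map_nth)
  ultimately show ?thesis
    by (rule computable_on_cong[OF _ arg_cong])
qed

lemma computable_on_hd_drop: "i < n \<Longrightarrow> computable_on n (\<lambda>xs. hd (drop i xs))"
  by (rule computable_on_cong[OF computable_on_nth[of i]]) (simp_all add: hd_drop_conv_nth)

lemmas computable_on_var =
  computable_on_hd_drop[of 0, unfolded drop_0]
  computable_on_hd_drop[of "Suc 0", unfolded drop_Suc drop_0]
  computable_on_hd_drop[of "Suc (Suc 0)", unfolded drop_Suc drop_0]

text \<open>Weakening: a term of the outer environment may be used under one more bound
  variable.\<close>

lemma computable_on_tl:
  assumes "computable_on n f"
  shows "computable_on (Suc n) (\<lambda>xs. f (tl xs))"
proof -
  let ?gs = "map (\<lambda>i xs. xs ! Suc i) [0..<n]"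
  have "computable_on (Suc n) (\<lambda>xs. f (map (\<lambda>g. g xs) ?gs))"
    by (rule computable_on_compose) (use assms computable_on_nth in auto)
  moreover have "map (\<lambda>g. g xs) ?gs = tl xs" if "length xs = Suc n" for xs
    using that by (intro nth_equalityI) (auto simp: nth_tl)
  ultimately show ?thesis
    by (rule computable_on_cong[OF _ arg_cong])
qed

text \<open>Under the recursor the two innermost variables are counter and accumulator. The summand
  of a sum sees the first but not the second.\<close>

lemma computable_on_skip:
  assumes "computable_on (Suc n) f"
  shows "computable_on (Suc (Suc n)) (\<lambda>xs. f (hd xs # tl (tl xs)))"
proof -
  let ?gs = "hd # map (\<lambda>i xs. xs ! Suc (Suc i)) [0..<n]"
  have "computable_on (Suc (Suc n)) (\<lambda>xs. f (map (\<lambda>g. g xs) ?gs))"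
    by (rule computable_on_compose) (use assms computable_on_nth computable_on_var(1) in auto)
  moreover have "map (\<lambda>g. g xs) ?gs = hd xs # tl (tl xs)" if "length xs = Suc (Suc n)" for xs
  proof -
    have "map (\<lambda>i. xs ! Suc (Suc i)) [0..<n] = tl (tl xs)"
      using that by (intro nth_equalityI) (auto simp: nth_tl)
    then show ?thesis by (simp add: comp_def)
  qed
  ultimately show ?thesis
    by (rule computable_on_cong[OF _ arg_cong])
qed

section \<open>Recursion, minimisation and arithmetic\<close>

lemma computable_on_Suc:
  assumes "computable_on n f"
  shows "computable_on n (\<lambda>xs. Suc (f xs))"
  using computable_on_compose_1[OF recursive_imp_computable_on[OF recursive_fn.succ] assms] by simp

lemma computable_on_const: "computable_on n (\<lambda>xs. c)"
proof (induction c)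
  case 0
  show ?case by (intro recursive_imp_computable_on recursive_fn.zero)
qed (rule computable_on_Suc)

lemma computable_on_rec_nat:
  assumes f: "computable_on n f"
    and g: "computable_on (Suc (Suc n)) (\<lambda>ys. g (hd ys) (hd (tl ys)) (tl (tl ys)))"
    and b: "computable_on n b"
  shows "computable_on n (\<lambda>xs. rec_nat (f xs) (\<lambda>k r. g k r xs) (b xs))"
proof -
  obtain f' where f': "recursive_fn n f'" "\<And>xs. length xs = n \<Longrightarrow> f' xs = f xs"
    using f unfolding computable_on_def by blast
  obtain g' where g': "recursive_fn (Suc (Suc n)) g'"
    "\<And>ys. length ys = Suc (Suc n) \<Longrightarrow> g' ys = g (hd ys) (hd (tl ys)) (tl (tl ys))"
    using g unfolding computable_on_def by blast
  have "computable_on n (\<lambda>xs. (\<lambda>ys. rec_nat (f' (tl ys)) (\<lambda>k r. g' (k # r # tl ys)) (hd ys)) (b xs # xs))"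
    by (intro computable_on_compose_Cons recursive_imp_computable_on recursive_fn.prim_rec f' g' b)
  then show ?thesis
    by (rule computable_on_cong) (simp add: f' g')
qed

lemma computable_on_Least:
  assumes P: "decidable_on (Suc n) (\<lambda>ys. P (hd ys) (tl ys))"
    and ex: "\<And>xs. length xs = n \<Longrightarrow> \<exists>k. P k xs"
  shows "computable_on n (\<lambda>xs. LEAST k. P k xs)"
proof -
  \<comment> \<open>Minimisation searches for a zero, so the truth value has to be flipped.
    Recursion on it does this before subtraction is available.\<close>
  have "computable_on (Suc n) (\<lambda>ys. rec_nat 1 (\<lambda>k r. 0) (of_bool (P (hd ys) (tl ys))))"
    by (rule computable_on_rec_nat[where g = "\<lambda>_ _ _. 0"])
      (use P in \<open>auto simp: decidable_on_def intro: computable_on_const\<close>)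
  then obtain g where g: "recursive_fn (Suc n) g"
    "\<And>ys. length ys = Suc n \<Longrightarrow> g ys = rec_nat 1 (\<lambda>k r. 0) (of_bool (P (hd ys) (tl ys)) :: nat)"
    unfolding computable_on_def by blast
  have g': "g (k # xs) = 0 \<longleftrightarrow> P k xs" if "length xs = n" for k xs
    using that by (cases "P k xs") (simp_all add: g)
  have "recursive_fn n (\<lambda>xs. LEAST k. g (k # xs) = 0)"
    by (rule recursive_fn.minim[OF g(1)]) (simp add: g' ex)
  then show ?thesis
    unfolding computable_on_def using g' by auto
qed

lemma computable_on_add:
  assumes "computable_on n f" "computable_on n g"
  shows "computable_on n (\<lambda>xs. f xs + g xs)"
proof -
  have "rec_nat a (\<lambda>k r. Suc r) b = a + b" for a b by (induction b) auto
  with computable_on_rec_nat[OF assms(1) _ assms(2), of "\<lambda>k r xs. Suc r"] show ?thesis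
    by (simp add: computable_on_Suc computable_on_var)
qed

lemma computable_on_mult:
  assumes "computable_on n f" "computable_on n g"
  shows "computable_on n (\<lambda>xs. f xs * g xs)"
proof -
  have "rec_nat 0 (\<lambda>k r. r + a) b = a * b" for a b by (induction b) auto
  with computable_on_rec_nat[OF _ _ assms(2), of "\<lambda>_. 0" "\<lambda>k r xs. r + f xs"] show ?thesis
    using computable_on_tl[OF computable_on_tl[OF assms(1)]]
    by (simp add: computable_on_const computable_on_var computable_on_add)
qed

lemma computable_on_power:
  assumes "computable_on n f" "computable_on n g"
  shows "computable_on n (\<lambda>xs. f xs ^ g xs)"
proof -
  have "rec_nat 1 (\<lambda>k r. r * a) b = a ^ b" for a b :: nat by (induction b) auto
  with computable_on_rec_nat[OF _ _ assms(2), of "\<lambda>_. 1" "\<lambda>k r xs. r * f xs"] show ?thesis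
    using computable_on_tl[OF computable_on_tl[OF assms(1)]]
    by (simp add: computable_on_const computable_on_var computable_on_mult)
qed

lemma computable_on_sum:
  assumes f: "computable_on (Suc n) (\<lambda>ys. f (hd ys) (tl ys))" and b: "computable_on n b"
  shows "computable_on n (\<lambda>xs. \<Sum>k<b xs. f k xs)"
proof -
  have "(\<Sum>k<m. h k) = rec_nat 0 (\<lambda>k r. r + h k) m" for h :: "nat \<Rightarrow> nat" and m
    by (induction m) auto
  moreover have "computable_on n (\<lambda>xs. rec_nat 0 (\<lambda>k r. r + f k xs) (b xs))"
  proof (rule computable_on_rec_nat[OF computable_on_const _ b])
    show "computable_on (Suc (Suc n)) (\<lambda>ys. hd (tl ys) + f (hd ys) (tl (tl ys)))"
      using computable_on_skip[OF f] by (simp add: computable_on_add computable_on_var)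
  qed
  ultimately show ?thesis by simp
qed

lemma computable_on_pred:
  assumes "computable_on n f"
  shows "computable_on n (\<lambda>xs. f xs - 1)"
proof -
  have "rec_nat 0 (\<lambda>k r. k) b = b - 1" for b by (induction b) auto
  with computable_on_rec_nat[OF _ _ assms, of "\<lambda>_. 0" "\<lambda>k r xs. k"] show ?thesis
    by (simp add: computable_on_const computable_on_var)
qed

lemma computable_on_diff:
  assumes "computable_on n f" "computable_on n g"
  shows "computable_on n (\<lambda>xs. f xs - g xs)"
proof -
  have "rec_nat a (\<lambda>k r. r - 1) b = a - b" for a b :: nat by (induction b) auto
  with computable_on_rec_nat[OF assms(1) _ assms(2), of "\<lambda>k r xs. r - 1"] show ?thesis
    by (simp add: computable_on_pred[unfolded One_nat_def] computable_on_var)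
qed

section \<open>Decidable predicates\<close>

lemma decidable_on_le:
  assumes "computable_on n f" "computable_on n g"
  shows "decidable_on n (\<lambda>xs. f xs \<le> g xs)"
proof -
  have "of_bool (f xs \<le> g xs) = 1 - (f xs - g xs)" for xs by simp
  then show ?thesis
    unfolding decidable_on_def using assms
    by (simp only:) (intro computable_on_diff computable_on_const)
qed

lemma decidable_on_not:
  assumes "decidable_on n P"
  shows "decidable_on n (\<lambda>xs. \<not> P xs)"
proof -
  have "of_bool (\<not> P xs) = 1 - (of_bool (P xs) :: nat)" for xs by simp
  then show ?thesis
    using assms unfolding decidable_on_def
    by (simp only:) (intro computable_on_diff computable_on_const)
qed

lemma decidable_on_conj:
  "decidable_on n P \<Longrightarrow> decidable_on n Q \<Longrightarrow> decidable_on n (\<lambda>xs. P xs \<and> Q xs)"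
  unfolding decidable_on_def of_bool_conj by (rule computable_on_mult)

lemma decidable_on_disj:
  "decidable_on n P \<Longrightarrow> decidable_on n Q \<Longrightarrow> decidable_on n (\<lambda>xs. P xs \<or> Q xs)"
  using decidable_on_not[OF decidable_on_conj[OF decidable_on_not decidable_on_not], of n P Q] by simp

lemma decidable_on_less:
  "computable_on n f \<Longrightarrow> computable_on n g \<Longrightarrow> decidable_on n (\<lambda>xs. f xs < g xs)"
  unfolding less_eq_Suc_le by (intro decidable_on_le computable_on_Suc)

lemma decidable_on_eq:
  fixes f g :: "nat list \<Rightarrow> nat"
  shows "computable_on n f \<Longrightarrow> computable_on n g \<Longrightarrow> decidable_on n (\<lambda>xs. f xs = g xs)"
  unfolding eq_iff by (intro decidable_on_le decidable_on_conj)

lemma decidable_on_ex: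
  assumes P: "decidable_on (Suc n) (\<lambda>ys. P (hd ys) (tl ys))" and b: "computable_on n b"
  shows "decidable_on n (\<lambda>xs. \<exists>k<b xs. P k xs)"
proof -
  have "0 < (\<Sum>k<b xs. of_bool (P k xs) :: nat) \<longleftrightarrow> (\<exists>k<b xs. P k xs)" for xs
    unfolding zero_less_iff_neq_zero by (subst sum_eq_0_iff) auto
  moreover have "decidable_on n (\<lambda>xs. 0 < (\<Sum>k<b xs. of_bool (P k xs) :: nat))"
    by (intro decidable_on_less computable_on_const computable_on_sum b)
      (use P in \<open>simp add: decidable_on_def\<close>)
  ultimately show ?thesis by simp
qed

lemma computable_on_if:
  assumes "decidable_on n P" "computable_on n f" "computable_on n g"
  shows "computable_on n (\<lambda>xs. if P xs then f xs else g xs)"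
proof -
  have "(if P xs then f xs else g xs) = of_bool (P xs) * f xs + of_bool (\<not> P xs) * g xs" for xs
    by simp
  then show ?thesis
    using assms decidable_on_not[OF assms(1)]
    by (simp only: decidable_on_def computable_on_add computable_on_mult)
qed

lemma computable_on_of_bool: "decidable_on n P \<Longrightarrow> computable_on n (\<lambda>xs. of_bool (P xs))"
  by (simp add: decidable_on_def)

text \<open>The quotient is the least \<open>k\<close> for which \<open>(k + 1) * c\<close> exceeds
  the dividend. The case \<open>c = 2\<close> serves to drop the last digit of a string code and to
  interleave sequences.\<close>

lemma computable_on_div:
  assumes f: "computable_on n f" and c: "0 < c"
  shows "computable_on n (\<lambda>xs. f xs div c)"
proof -
  have least: "(LEAST k. m < (k + 1) * c) = m div c" for m
  proof (rule Least_equality)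
    show "m < (m div c + 1) * c"
      using dividend_less_times_div[OF c] by (simp add: mult.commute)
    show "m div c \<le> k" if "m < (k + 1) * c" for k
      using less_mult_imp_div_less[OF that] by simp
  qed
  have "computable_on n (\<lambda>xs. LEAST k. f xs < (k + 1) * c)"
  proof (rule computable_on_Least)
    show "decidable_on (Suc n) (\<lambda>ys. f (tl ys) < (hd ys + 1) * c)"
      by (intro decidable_on_less computable_on_tl f computable_on_mult computable_on_add
          computable_on_const computable_on_var) simp
    show "\<exists>k. f xs < (k + 1) * c" for xs
      using c by (intro exI[of _ "f xs"]) (cases c; simp)
  qed
  then show ?thesis unfolding least .
qed

lemma computable_iff_computable_on: "computable f \<longleftrightarrow> computable_on 1 (\<lambda>xs. f (hd xs))"
proof
  assume "computable f"
  then obtain g where "recursive_fn 1 g" "\<forall>x. g [x] = f x" unfolding computable_def by blast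
  then show "computable_on 1 (\<lambda>xs. f (hd xs))"
    unfolding computable_on_def by (auto simp: length_Suc_conv)
next
  assume "computable_on 1 (\<lambda>xs. f (hd xs))"
  then obtain g where "recursive_fn 1 g" "\<forall>xs. length xs = 1 \<longrightarrow> g xs = f (hd xs)"
    unfolding computable_on_def by blast
  then show "computable f"
    unfolding computable_def by (metis One_nat_def length_Cons list.sel(1) list.size(3))
qed

lemma computable_on_computable:
  assumes "computable f" "computable_on n g"
  shows "computable_on n (\<lambda>xs. f (g xs))"
  using computable_on_compose_1[of "\<lambda>xs. f (hd xs)"] assms by (simp add: computable_iff_computable_on)

section \<open>Rational-valued computable functions\<close>

text \<open>The format of \<open>computable_rat_seq\<close> on environments. The equation holds on
  lists of every length, so it can be used as a plain rewrite rule.\<close>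

definition rat_computable_on :: "nat \<Rightarrow> (nat list \<Rightarrow> rat) \<Rightarrow> bool" where
  "rat_computable_on n F \<longleftrightarrow> (\<exists>p q r. computable_on n p \<and> computable_on n q \<and> computable_on n r \<and>
     (\<forall>xs. r xs > 0 \<and> F xs = (of_nat (p xs) - of_nat (q xs)) / of_nat (r xs)))"

lemma rat_computable_onI:
  assumes "computable_on n p" "computable_on n q" "computable_on n r"
    "\<And>xs. r xs > 0" "\<And>xs. F xs = (of_nat (p xs) - of_nat (q xs)) / of_nat (r xs)"
  shows "rat_computable_on n F"
  using assms unfolding rat_computable_on_def by blast

lemma rat_computable_onE:
  assumes "rat_computable_on n F"
  obtains p q r where "computable_on n p" "computable_on n q" "computable_on n r"
    "\<And>xs. r xs > 0" "\<And>xs. F xs = (of_nat (p xs) - of_nat (q xs)) / of_nat (r xs)"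
  using assms unfolding rat_computable_on_def by blast

lemma rat_computable_on_seq:
  assumes "computable_rat_seq a" "computable_on n f"
  shows "rat_computable_on n (\<lambda>xs. a (f xs))"
proof -
  obtain p q r where "computable p" "computable q" "computable r"
    and "\<And>s. r s > 0" "\<And>s. a s = (of_nat (p s) - of_nat (q s)) / of_nat (r s)"
    using assms(1) unfolding computable_rat_seq_def by blast
  then show ?thesis
    by (intro rat_computable_onI[of n "\<lambda>xs. p (f xs)" "\<lambda>xs. q (f xs)" "\<lambda>xs. r (f xs)"])
      (simp_all add: computable_on_computable assms(2))
qed

lemma computable_rat_seqI:
  assumes "rat_computable_on 1 (\<lambda>xs. a (hd xs))"
  shows "computable_rat_seq a"
proof -
  obtain p q r where pqr: "computable_on 1 p" "computable_on 1 q" "computable_on 1 r"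
    "\<And>xs. r xs > 0" "\<And>xs. a (hd xs) = (of_nat (p xs) - of_nat (q xs)) / of_nat (r xs)"
    using assms by (rule rat_computable_onE) blast
  have "computable (\<lambda>s. f [s])" if "computable_on 1 f" for f
    unfolding computable_iff_computable_on
    by (rule computable_on_cong[OF that]) (auto simp: length_Suc_conv)
  with pqr show ?thesis
    unfolding computable_rat_seq_def
    by (intro exI[of _ "\<lambda>s. p [s]"] exI[of _ "\<lambda>s. q [s]"] exI[of _ "\<lambda>s. r [s]"])
      (use pqr(5)[of "[_]"] in auto)
qed

lemma rat_computable_on_of_nat: "computable_on n f \<Longrightarrow> rat_computable_on n (\<lambda>xs. of_nat (f xs))"
  by (rule rat_computable_onI[of n f "\<lambda>_. 0" "\<lambda>_. 1"]) (simp_all add: computable_on_const)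

lemma rat_computable_on_const: "rat_computable_on n (\<lambda>xs. c)"
proof -
  obtain a b where ab: "c = of_int a / of_int b" "b > 0"
    by (metis Fract_of_int_quotient quotient_of_denom_pos quotient_of_div surj_pair)
  have "(of_int a :: rat) = of_nat (nat a) - of_nat (nat (- a))"
    by (cases "a \<ge> 0") auto
  with ab show ?thesis
    by (intro rat_computable_onI[of n "\<lambda>_. nat a" "\<lambda>_. nat (- a)" "\<lambda>_. nat b"])
      (simp_all add: computable_on_const)
qed

lemma rat_computable_on_uminus:
  assumes "rat_computable_on n F"
  shows "rat_computable_on n (\<lambda>xs. - F xs)"
proof -
  obtain p q r where "computable_on n p" "computable_on n q" "computable_on n r"
    "\<And>xs. r xs > 0" "\<And>xs. F xs = (of_nat (p xs) - of_nat (q xs)) / of_nat (r xs)"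
    using assms by (rule rat_computable_onE) blast
  then show ?thesis
    by (intro rat_computable_onI[of n q p r]) (simp_all add: field_simps)
qed

lemma rat_computable_on_add:
  assumes "rat_computable_on n F" "rat_computable_on n G"
  shows "rat_computable_on n (\<lambda>xs. F xs + G xs)"
proof -
  obtain p q r where 1: "computable_on n p" "computable_on n q" "computable_on n r"
    "\<And>xs. r xs > 0" "\<And>xs. F xs = (of_nat (p xs) - of_nat (q xs)) / of_nat (r xs)"
    using assms(1) by (rule rat_computable_onE) blast
  obtain p' q' r' where 2: "computable_on n p'" "computable_on n q'" "computable_on n r'"
    "\<And>xs. r' xs > 0" "\<And>xs. G xs = (of_nat (p' xs) - of_nat (q' xs)) / of_nat (r' xs)"
    using assms(2) by (rule rat_computable_onE) blast
  have [simp]: "r xs \<noteq> 0" "r' xs \<noteq> 0" for xs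
    using 1(4)[of xs] 2(4)[of xs] by auto
  show ?thesis
    by (rule rat_computable_onI[of n "\<lambda>xs. p xs * r' xs + p' xs * r xs"
          "\<lambda>xs. q xs * r' xs + q' xs * r xs" "\<lambda>xs. r xs * r' xs"])
      (simp_all add: 1 2 computable_on_add computable_on_mult field_simps)
qed

lemma rat_computable_on_diff:
  "rat_computable_on n F \<Longrightarrow> rat_computable_on n G \<Longrightarrow> rat_computable_on n (\<lambda>xs. F xs - G xs)"
  using rat_computable_on_add[OF _ rat_computable_on_uminus] by simp

lemma rat_computable_on_mult:
  assumes "rat_computable_on n F" "rat_computable_on n G"
  shows "rat_computable_on n (\<lambda>xs. F xs * G xs)"
proof -
  obtain p q r where 1: "computable_on n p" "computable_on n q" "computable_on n r"
    "\<And>xs. r xs > 0" "\<And>xs. F xs = (of_nat (p xs) - of_nat (q xs)) / of_nat (r xs)"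
    using assms(1) by (rule rat_computable_onE) blast
  obtain p' q' r' where 2: "computable_on n p'" "computable_on n q'" "computable_on n r'"
    "\<And>xs. r' xs > 0" "\<And>xs. G xs = (of_nat (p' xs) - of_nat (q' xs)) / of_nat (r' xs)"
    using assms(2) by (rule rat_computable_onE) blast
  have [simp]: "r xs \<noteq> 0" "r' xs \<noteq> 0" for xs
    using 1(4)[of xs] 2(4)[of xs] by auto
  show ?thesis
    by (rule rat_computable_onI[of n "\<lambda>xs. p xs * p' xs + q xs * q' xs"
          "\<lambda>xs. q xs * p' xs + p xs * q' xs" "\<lambda>xs. r xs * r' xs"])
      (simp_all add: 1 2 computable_on_add computable_on_mult field_simps)
qed

lemma rat_computable_on_power:
  assumes "computable_on n f"
  shows "rat_computable_on n (\<lambda>xs. (1 / 2) ^ f xs)"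
  by (rule rat_computable_onI[of n "\<lambda>_. 1" "\<lambda>_. 0" "\<lambda>xs. 2 ^ f xs"])
    (simp_all add: assms computable_on_const computable_on_power power_one_over)

lemma rat_computable_on_if:
  assumes P: "decidable_on n P" and "rat_computable_on n F" "rat_computable_on n G"
  shows "rat_computable_on n (\<lambda>xs. if P xs then F xs else G xs)"
proof -
  have "(if P xs then F xs else G xs) =
      of_nat (of_bool (P xs)) * F xs + of_nat (of_bool (\<not> P xs)) * G xs" for xs
    by simp
  then show ?thesis
    using assms decidable_on_not[OF P]
    by (simp only: decidable_on_def rat_computable_on_add rat_computable_on_mult rat_computable_on_of_nat)
qed

text \<open>Over a positive denominator, the sign of \<open>G xs - F xs\<close> is decided by
  comparing the two natural numbers in its numerator.\<close>

lemma decidable_on_rat_le: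
  assumes "rat_computable_on n F" "rat_computable_on n G"
  shows "decidable_on n (\<lambda>xs. F xs \<le> G xs)"
proof -
  obtain p q r where 1: "computable_on n p" "computable_on n q" "computable_on n r"
    "\<And>xs. r xs > 0" "\<And>xs. G xs - F xs = (of_nat (p xs) - of_nat (q xs)) / of_nat (r xs)"
    using rat_computable_on_diff[OF assms(2,1)] by (rule rat_computable_onE) blast
  have "F xs \<le> G xs \<longleftrightarrow> q xs \<le> p xs" for xs
    using 1(4)[of xs] by (subst diff_ge_0_iff_ge[symmetric]) (simp add: 1(5) zero_le_divide_iff)
  then show ?thesis
    by (simp add: 1 decidable_on_le)
qed

lemma decidable_on_rat_less:
  fixes F G :: "nat list \<Rightarrow> rat"
  shows "rat_computable_on n F \<Longrightarrow> rat_computable_on n G \<Longrightarrow> decidable_on n (\<lambda>xs. F xs < G xs)"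
  unfolding not_le[symmetric] by (intro decidable_on_not decidable_on_rat_le)

text \<open>A syntax-directed rule system: later computability goals are solved by following the
  shape of the term.\<close>

lemmas computable_on_intros =
  computable_on_var computable_on_const computable_on_Suc computable_on_add computable_on_mult
  computable_on_power computable_on_diff computable_on_sum computable_on_if computable_on_of_bool
  decidable_on_not decidable_on_conj decidable_on_disj decidable_on_le decidable_on_less
  decidable_on_eq decidable_on_ex
  rat_computable_on_const rat_computable_on_of_nat rat_computable_on_uminus rat_computable_on_add
  rat_computable_on_diff rat_computable_on_mult rat_computable_on_power rat_computable_on_if
  decidable_on_rat_le decidable_on_rat_less

section \<open>Binary strings and dyadic intervals\<close>

text \<open>Removing the leading 1 of the code leaves the number with binary numeral \<sigma>, so
  \<open>string_value \<sigma> / 2 ^ length \<sigma>\<close> is the left endpoint of the dyadic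
  interval of \<sigma>.\<close>

definition string_value :: "bool list \<Rightarrow> nat" where
  "string_value \<sigma> = string_code \<sigma> - 2 ^ length \<sigma>"

lemma string_code_Nil [simp]: "string_code [] = 1"
  by (simp add: string_code_def)

lemma string_code_snoc [simp]: "string_code (\<sigma> @ [b]) = of_bool b + 2 * string_code \<sigma>"
  by (simp add: string_code_def)

lemma string_code_bounds: "2 ^ length \<sigma> \<le> string_code \<sigma>" "string_code \<sigma> < 2 ^ Suc (length \<sigma>)"
  by (induction \<sigma> rule: rev_induct) (auto simp: of_bool_def)

lemma string_value_Nil [simp]: "string_value [] = 0"
  by (simp add: string_value_def)

lemma string_value_snoc [simp]: "string_value (\<sigma> @ [b]) = of_bool b + 2 * string_value \<sigma>"
  using string_code_bounds(1)[of \<sigma>] by (simp add: string_value_def)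

lemma string_value_less: "string_value \<sigma> < 2 ^ length \<sigma>"
  using string_code_bounds[of \<sigma>] by (simp add: string_value_def)

text \<open>The bridge between digits and intervals. In the induction, the floor at the finer scale
  splits into its half, which encodes the shorter string, and its parity, which is the new
  digit.\<close>

lemma floor_eq_string_value_iff:
  assumes "0 \<le> x" "x < 1"
  shows "\<lfloor>x * 2 ^ length \<sigma>\<rfloor> = int (string_value \<sigma>) \<longleftrightarrow> (\<forall>i<length \<sigma>. binary_expansion x i = \<sigma> ! i)"
proof (induction \<sigma> rule: rev_induct)
  case Nil
  show ?case using assms by (simp add: floor_eq_iff)
next
  case (snoc b \<sigma>)
  let ?m = "\<lfloor>x * 2 ^ Suc (length \<sigma>)\<rfloor>"
  have half: "\<lfloor>x * 2 ^ length \<sigma>\<rfloor> = ?m div 2"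
    using floor_divide_real_eq_div[of 2 "x * 2 ^ Suc (length \<sigma>)"] by simp
  have "?m = of_bool b + 2 * int (string_value \<sigma>) \<longleftrightarrow> ?m div 2 = int (string_value \<sigma>) \<and> odd ?m = b"
    by (cases b) (simp_all, presburger+)
  then show ?case
    using snoc unfolding half
    by (auto simp: nth_append binary_expansion_def less_Suc_eq)
qed

lemma mem_cylinders_iff:
  assumes "0 \<le> x" "x < 1"
  shows "binary_expansion x \<in> cylinders E \<longleftrightarrow> (\<exists>\<sigma>\<in>E. \<lfloor>x * 2 ^ length \<sigma>\<rfloor> = int (string_value \<sigma>))"
  by (simp add: floor_eq_string_value_iff[OF assms] cylinders_def)

text \<open>Initial segments of the same sequence are comparable, which prefix-freeness allows only
  for equal strings.\<close>

lemma prefix_freeD_agree: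
  assumes "prefix_free E" "\<sigma> \<in> E" "\<tau> \<in> E"
    and X: "\<forall>i<length \<sigma>. X i = \<sigma> ! i" "\<forall>i<length \<tau>. X i = \<tau> ! i"
  shows "\<sigma> = \<tau>"
proof -
  have eq: "\<rho> = map X [0..<length \<rho>]" if "\<forall>i<length \<rho>. X i = \<rho> ! i" for \<rho>
    using that by (intro nth_equalityI) auto
  have "prefix (map X [0..<m]) (map X [0..<n])" if "m \<le> n" for m n
    using that upt_add_eq_append[of 0 m "n - m"] by (metis le_add_diff_inverse map_append prefixI zero_le)
  then have "prefix \<sigma> \<tau> \<or> prefix \<tau> \<sigma>"
    using eq[OF X(1)] eq[OF X(2)] by (metis nat_le_linear)
  then show ?thesis
    using assms(1-3) unfolding prefix_free_def by metis
qed

section \<open>Fair-coin measure of cylinders\<close>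

lemma cylinders_UN: "cylinders E = (\<Union>\<sigma>\<in>E. cylinders {\<sigma>})"
  by (auto simp: cylinders_def)

lemma emeasure_cylinders_single:
  "cylinders {\<sigma>} \<in> sets cantor_measure"
  "emeasure cantor_measure (cylinders {\<sigma>}) = ennreal ((1 / 2) ^ length \<sigma>)"
proof -
  let ?M = "\<lambda>_::nat. measure_pmf (bernoulli_pmf (1 / 2))"
  interpret product_prob_space ?M UNIV ..
  have sp: "space (PiM UNIV ?M) = UNIV" by (auto simp: space_PiM)
  have eq: "cylinders {\<sigma>} = {X \<in> space (PiM UNIV ?M). \<forall>i\<in>{..<length \<sigma>}. X i \<in> {\<sigma> ! i}}"
    by (auto simp: cylinders_def sp)
  show "cylinders {\<sigma>} \<in> sets cantor_measure"
    unfolding eq cantor_measure_def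
  proof (rule sets.sets_Collect_finite_All)
    fix i
    have "(\<lambda>X. X i) -` {\<sigma> ! i} \<inter> space (PiM UNIV ?M) \<in> sets (PiM UNIV ?M)"
      by (rule measurable_sets[OF measurable_component_singleton]) auto
    then show "{X \<in> space (PiM UNIV ?M). X i \<in> {\<sigma> ! i}} \<in> sets (PiM UNIV ?M)"
      by (simp add: vimage_def Int_def conj_commute)
  qed simp
  have "emeasure cantor_measure (cylinders {\<sigma>}) = (\<Prod>i<length \<sigma>. emeasure (?M i) {\<sigma> ! i})"
    unfolding eq cantor_measure_def by (rule emeasure_PiM_Collect) auto
  also have "\<dots> = (\<Prod>i<length \<sigma>. ennreal (1 / 2))"
    by (intro prod.cong refl) (simp add: emeasure_pmf_single pmf_bernoulli_half)
  also have "\<dots> = ennreal ((1 / 2) ^ length \<sigma>)"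
    by (subst prod_constant, subst ennreal_power) simp_all
  finally show "emeasure cantor_measure (cylinders {\<sigma>}) = ennreal ((1 / 2) ^ length \<sigma>)" .
qed

text \<open>There are only countably many strings, so the union of their cylinders is
  measurable.\<close>

lemma sets_cylinders: "cylinders E \<in> sets cantor_measure"
  by (subst cylinders_UN) (intro sets.countable_UN'' countableI_type emeasure_cylinders_single(1))

lemma emeasure_cylinders_finite:
  assumes "finite F" "prefix_free F"
  shows "emeasure cantor_measure (cylinders F) = ennreal (\<Sum>\<sigma>\<in>F. (1 / 2) ^ length \<sigma>)"
proof -
  have "disjoint_family_on (\<lambda>\<sigma>. cylinders {\<sigma>}) F"
    unfolding disjoint_family_on_def
    using prefix_freeD_agree[OF assms(2)] by (auto simp: cylinders_def)
  then have "emeasure cantor_measure (cylinders F) = (\<Sum>\<sigma>\<in>F. emeasure cantor_measure (cylinders {\<sigma>}))"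
    by (subst cylinders_UN, intro sum_emeasure[symmetric]) (use assms emeasure_cylinders_single in auto)
  then show ?thesis
    by (simp add: emeasure_cylinders_single(2) sum_ennreal)
qed

lemma prefix_free_subset: "prefix_free E \<Longrightarrow> F \<subseteq> E \<Longrightarrow> prefix_free F"
  unfolding prefix_free_def by blast

lemma sum_le_of_emeasure_cylinders_le:
  assumes "prefix_free E" "emeasure cantor_measure (cylinders E) \<le> ennreal B" "0 \<le> B"
    and "finite F" "F \<subseteq> E"
  shows "(\<Sum>\<sigma>\<in>F. (1 / 2) ^ length \<sigma>) \<le> B"
proof -
  have "emeasure cantor_measure (cylinders F) \<le> emeasure cantor_measure (cylinders E)"
    by (rule emeasure_mono[OF _ sets_cylinders]) (use assms(5) in \<open>auto simp: cylinders_def\<close>)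
  also note assms(2)
  finally show ?thesis
    using assms by (simp add: emeasure_cylinders_finite prefix_free_subset)
qed

text \<open>Continuity from below along the finite sets of strings of length at most
  \<open>n\<close>.\<close>

lemma emeasure_cylinders_le:
  assumes "prefix_free E" "0 \<le> B"
    and le: "\<And>F. finite F \<Longrightarrow> F \<subseteq> E \<Longrightarrow> (\<Sum>\<sigma>\<in>F. (1 / 2) ^ length \<sigma>) \<le> B"
  shows "emeasure cantor_measure (cylinders E) \<le> ennreal B"
proof -
  define C where "C n = {\<sigma> \<in> E. length \<sigma> \<le> n}" for n
  have C: "finite (C n)" "C n \<subseteq> E" for n
    by (rule finite_subset[OF _ finite_lists_length_le[of UNIV n]]) (auto simp: C_def)
  have "cylinders E = (\<Union>n. cylinders (C n))"
    by (auto simp: cylinders_def C_def)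
  moreover have "incseq (\<lambda>n. cylinders (C n))"
    by (auto simp: incseq_def cylinders_def C_def)
  ultimately have "emeasure cantor_measure (cylinders E) = (SUP n. emeasure cantor_measure (cylinders (C n)))"
    by (simp add: SUP_emeasure_incseq sets_cylinders image_subset_iff)
  also have "\<dots> \<le> ennreal B"
    using C prefix_free_subset[OF assms(1)] assms(2)
    by (intro SUP_least) (simp add: emeasure_cylinders_finite le)
  finally show ?thesis .
qed

section \<open>Dyadic intervals of strings\<close>

definition dyadic_inside :: "bool list \<Rightarrow> real \<Rightarrow> real \<Rightarrow> bool" where
  "dyadic_inside \<sigma> l r \<longleftrightarrow>
     l \<le> string_value \<sigma> / 2 ^ length \<sigma> \<and> (string_value \<sigma> + 1) / 2 ^ length \<sigma> \<le> r"

lemma dyadic_inside_snoc: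
  assumes "dyadic_inside \<sigma> l r"
  shows "dyadic_inside (\<sigma> @ [b]) l r"
  using assms by (cases b) (auto simp: dyadic_inside_def field_simps)

text \<open>Strings of a prefix-free set have disjoint dyadic intervals, so their lengths add up to
  at most the length of an interval containing them all.\<close>

lemma sum_dyadic_inside_le:
  assumes F: "finite F" "prefix_free F" and "l \<le> r"
    and inside: "\<And>\<sigma>. \<sigma> \<in> F \<Longrightarrow> dyadic_inside \<sigma> l r"
  shows "(\<Sum>\<sigma>\<in>F. (1 / 2) ^ length \<sigma>) \<le> r - l"
proof -
  \<comment> \<open>Half-open, since adjacent closed intervals would share an endpoint. Membership
    is then the floor condition.\<close>
  define D where "D \<sigma> = {string_value \<sigma> / 2 ^ length \<sigma> ..< (string_value \<sigma> + 1) / 2 ^ length \<sigma>}"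
    for \<sigma> :: "bool list"
  have D_iff: "x \<in> D \<sigma> \<longleftrightarrow> \<lfloor>x * 2 ^ length \<sigma>\<rfloor> = int (string_value \<sigma>)" for x \<sigma>
    by (simp add: D_def floor_eq_iff field_simps)
  have D01: "0 \<le> x \<and> x < 1" if "x \<in> D \<sigma>" for x \<sigma>
  proof -
    have "real (string_value \<sigma> + 1) / 2 ^ length \<sigma> \<le> 1"
      using string_value_less[of \<sigma>] by (simp add: field_simps flip: of_nat_Suc)
    moreover have "0 \<le> string_value \<sigma> / (2 ^ length \<sigma> :: real)" by simp
    ultimately show ?thesis using that unfolding D_def by (auto simp only: atLeastLessThan_iff)
  qed
  have "disjoint_family_on D F"
    unfolding disjoint_family_on_def
  proof (intro ballI impI, rule ccontr)
    \<comment> \<open>Both strings would be initial segments of the expansion of a common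
      point.\<close>
    fix \<sigma> \<tau> assume st: "\<sigma> \<in> F" "\<tau> \<in> F" "\<sigma> \<noteq> \<tau>" "D \<sigma> \<inter> D \<tau> \<noteq> {}"
    then obtain x where x: "x \<in> D \<sigma>" "x \<in> D \<tau>" by auto
    then have "0 \<le> x" "x < 1" using D01 by auto
    from x[unfolded D_iff floor_eq_string_value_iff[OF this]] st prefix_freeD_agree[OF F(2)]
    show False by metis
  qed
  moreover have "D ` F \<subseteq> sets lborel" by (auto simp: D_def)
  ultimately have "(\<Sum>\<sigma>\<in>F. emeasure lborel (D \<sigma>)) = emeasure lborel (\<Union>\<sigma>\<in>F. D \<sigma>)"
    by (intro sum_emeasure F)
  also have "\<dots> \<le> emeasure lborel {l..r}"
  proof (rule emeasure_mono)
    show "(\<Union>\<sigma>\<in>F. D \<sigma>) \<subseteq> {l..r}"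
      using inside unfolding D_def dyadic_inside_def by fastforce
  qed simp
  also have "\<dots> = ennreal (r - l)" using \<open>l \<le> r\<close> by simp
  also have "(\<Sum>\<sigma>\<in>F. emeasure lborel (D \<sigma>)) = (\<Sum>\<sigma>\<in>F. ennreal ((1 / 2) ^ length \<sigma>))"
    by (intro sum.cong refl) (simp add: D_def divide_right_mono flip: diff_divide_distrib, simp add: power_one_over)
  also have "\<dots> = ennreal (\<Sum>\<sigma>\<in>F. (1 / 2) ^ length \<sigma>)"
    by (simp add: sum_ennreal)
  finally show ?thesis using \<open>l \<le> r\<close> by simp
qed

section \<open>Tests from computable sequences of intervals\<close>

text \<open>The position of the leading binary digit, found by minimisation. It recovers the length
  of a string from its code.\<close>

definition code_length :: "nat \<Rightarrow> nat" where
  "code_length j = (LEAST n. j < 2 ^ Suc n)"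

lemma code_length_string_code [simp]: "code_length (string_code \<sigma>) = length \<sigma>"
  unfolding code_length_def
proof (rule Least_equality)
  show "string_code \<sigma> < 2 ^ Suc (length \<sigma>)" by (rule string_code_bounds)
  show "length \<sigma> \<le> n" if "string_code \<sigma> < 2 ^ Suc n" for n
  proof -
    have "(2::nat) ^ length \<sigma> < 2 ^ Suc n"
      using string_code_bounds(1)[of \<sigma>] that by (rule le_less_trans)
    then have "length \<sigma> < Suc n" by (rule power_less_imp_less_exp[rotated]) simp
    then show ?thesis by simp
  qed
qed

lemma computable_on_code_length:
  assumes "computable_on n f"
  shows "computable_on n (\<lambda>xs. code_length (f xs))"
  unfolding code_length_def
proof (rule computable_on_Least)
  show "decidable_on (Suc n) (\<lambda>ys. f (tl ys) < 2 ^ Suc (hd ys))"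
    by (intro computable_on_intros computable_on_tl[OF assms]) simp
  show "\<exists>k. f xs < 2 ^ Suc k" for xs
    by (rule exI[of _ "f xs"]) (rule less_le_trans[OF less_exp], simp)
qed

text \<open>Replaces real inequalities by rational ones, which are decidable.\<close>

lemma dyadic_inside_of_rat_iff:
  "dyadic_inside \<sigma> (real_of_rat l) (real_of_rat r) \<longleftrightarrow>
     l \<le> of_nat (string_value \<sigma>) * (1 / 2) ^ length \<sigma> \<and>
     of_nat (Suc (string_value \<sigma>)) * (1 / 2) ^ length \<sigma> \<le> r"
proof -
  have "real (string_value \<sigma>) / 2 ^ length \<sigma> = real_of_rat (of_nat (string_value \<sigma>) * (1 / 2) ^ length \<sigma>)"
    "real (string_value \<sigma> + 1) / 2 ^ length \<sigma> = real_of_rat (of_nat (Suc (string_value \<sigma>)) * (1 / 2) ^ length \<sigma>)"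
    by (simp_all add: of_rat_mult of_rat_power of_rat_divide of_rat_add power_one_over)
  then show ?thesis
    unfolding dyadic_inside_def by (simp only: of_rat_less_eq)
qed

text \<open>The dyadic interval of length \<open>(1 / 2) ^ n\<close> that contains \<open>x\<close>
  fits as soon as this length is below both distances from \<open>x\<close> to the
  endpoints.\<close>

lemma eventually_dyadic_inside:
  assumes "0 \<le> x" "x < 1" "l < x" "x < r"
  shows "eventually (\<lambda>n. dyadic_inside (map (binary_expansion x) [0..<n]) l r) sequentially"
proof -
  have "(\<lambda>n. (1 / 2) ^ n :: real) \<longlonglongrightarrow> 0" by (rule LIMSEQ_power_zero) simp
  then have "eventually (\<lambda>n. (1 / 2) ^ n < min (x - l) (r - x)) sequentially"
    by (rule order_tendstoD) (use assms in simp)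
  then show ?thesis
  proof eventually_elim
    case (elim n)
    let ?s = "map (binary_expansion x) [0..<n]"
    have "\<lfloor>x * 2 ^ n\<rfloor> = int (string_value ?s)"
      using floor_eq_string_value_iff[OF assms(1,2), of ?s] by simp
    then have "real (string_value ?s) \<le> x * 2 ^ n" "x * 2 ^ n < real (string_value ?s) + 1"
      by (simp_all add: floor_eq_iff)
    then have "string_value ?s / 2 ^ n \<le> x" "x < (real (string_value ?s) + 1) / 2 ^ n"
      by (simp_all add: pos_divide_le_eq pos_less_divide_eq)
    moreover have "(real (string_value ?s) + 1) / 2 ^ n = string_value ?s / 2 ^ n + (1 / 2) ^ n"
      by (simp add: add_divide_distrib power_one_over)
    ultimately have "l \<le> string_value ?s / 2 ^ n" "(real (string_value ?s) + 1) / 2 ^ n \<le> r"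
      using elim by linarith+
    then show ?case
      by (simp add: dyadic_inside_def add.commute)
  qed
qed

section \<open>The test given by a sequence of intervals\<close>

text \<open>The total length is bounded by a power of two, so that requiring membership in
  \<open>2 ^ (i + c)\<close> intervals brings the measure down to
  \<open>(1 / 2) ^ i\<close>.\<close>

locale interval_cover =
  fixes l r :: "nat \<Rightarrow> rat" and c :: nat
  assumes computable_l: "computable_rat_seq l" and computable_r: "computable_rat_seq r"
    and summable: "summable (\<lambda>s. \<bar>real_of_rat (l s) - real_of_rat (r s)\<bar>)"
    and total: "(\<Sum>s. \<bar>real_of_rat (l s) - real_of_rat (r s)\<bar>) \<le> 2 ^ c"
begin

definition inside :: "nat \<Rightarrow> bool list \<Rightarrow> bool" where
  "inside s \<sigma> \<longleftrightarrow> dyadic_inside \<sigma> (real_of_rat (l s)) (real_of_rat (r s)) \<or>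
     dyadic_inside \<sigma> (real_of_rat (r s)) (real_of_rat (l s))"

definition heavy :: "nat \<Rightarrow> bool list \<Rightarrow> bool" where
  "heavy i \<sigma> \<longleftrightarrow> 2 ^ (i + c) \<le> (\<Sum>s<length \<sigma>. of_bool (inside s \<sigma>) :: nat)"

text \<open>Minimal heavy strings are decidable because a string of length \<open>n\<close> is only tested against the
  first \<open>n\<close> intervals.\<close>

definition test :: "nat \<Rightarrow> bool list set" where
  "test i = {\<sigma>. heavy i \<sigma> \<and> \<not> heavy i (butlast \<sigma>)}"

text \<open>Extending a string shrinks its dyadic interval and admits one more interval to the
  count, so the count cannot drop.\<close>

lemma heavy_snoc:
  assumes "heavy i \<sigma>"
  shows "heavy i (\<sigma> @ [b])"
proof -
  have "(\<Sum>s<length \<sigma>. of_bool (inside s \<sigma>) :: nat) \<le> (\<Sum>s<length \<sigma>. of_bool (inside s (\<sigma> @ [b])))"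
    by (intro sum_mono) (auto simp: inside_def dyadic_inside_snoc)
  then show ?thesis
    using assms unfolding heavy_def by simp
qed

lemma heavy_prefix:
  assumes "heavy i \<sigma>" "prefix \<sigma> \<tau>"
  shows "heavy i \<tau>"
proof -
  have "heavy i (\<sigma> @ \<rho>)" for \<rho>
    by (induction \<rho> rule: rev_induct) (use assms(1) heavy_snoc in \<open>simp_all flip: append_assoc\<close>)
  then show ?thesis using assms(2) by (auto elim: prefixE)
qed

lemma prefix_free_test: "prefix_free (test i)"
  unfolding prefix_free_def
proof (intro ballI impI, rule ccontr)
  fix \<sigma> \<tau> assume *: "\<sigma> \<in> test i" "\<tau> \<in> test i" "prefix \<sigma> \<tau>" "\<sigma> \<noteq> \<tau>"
  \<comment> \<open>A proper prefix of \<tau> survives the removal of the last digit. Its heaviness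
    would then contradict the minimality of \<tau>.\<close>
  then have "prefix \<sigma> (butlast \<tau>)"
    by (cases \<tau> rule: rev_cases) auto
  with * show False unfolding test_def by (auto dest: heavy_prefix)
qed

lemma sum_inside_le:
  assumes "finite F" "prefix_free F"
  shows "(\<Sum>\<sigma>\<in>F. of_bool (inside s \<sigma>) * (1 / 2) ^ length \<sigma>) \<le> \<bar>real_of_rat (l s) - real_of_rat (r s)\<bar>"
proof -
  let ?l = "real_of_rat (l s)" and ?r = "real_of_rat (r s)"
  \<comment> \<open>This determines which endpoint is the smaller one, so both orientations reduce
    to the interval from the minimum to the maximum.\<close>
  have lt: "x < y" if "dyadic_inside \<sigma> x y" for \<sigma> x y
  proof -
    have "string_value \<sigma> / 2 ^ length \<sigma> < (string_value \<sigma> + 1) / (2 ^ length \<sigma> :: real)"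
      by (simp add: divide_strict_right_mono)
    with that show ?thesis unfolding dyadic_inside_def by linarith
  qed
  have "(\<Sum>\<sigma>\<in>F. of_bool (inside s \<sigma>) * (1 / 2) ^ length \<sigma>) = (\<Sum>\<sigma>\<in>{\<sigma> \<in> F. inside s \<sigma>}. (1 / 2) ^ length \<sigma> :: real)"
    using assms(1) by (intro sum.mono_neutral_cong_right) auto
  also have "\<dots> \<le> max ?l ?r - min ?l ?r"
    by (intro sum_dyadic_inside_le prefix_free_subset[OF assms(2)])
      (use assms(1) in \<open>auto simp: inside_def min_def max_def dest: lt\<close>)
  also have "\<dots> = \<bar>?l - ?r\<bar>" by linarith
  finally show ?thesis .
qed

text \<open>Double counting: every string of the test is counted by at least
  \<open>2 ^ (i + c)\<close> intervals, while the strings inside one interval weigh at most its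
  length. Swapping the sums gives \<open>2 ^ (i + c)\<close> times the weight at most
  \<open>2 ^ c\<close>.\<close>

lemma sum_test_le:
  assumes F: "finite F" "F \<subseteq> test i"
  shows "(\<Sum>\<sigma>\<in>F. (1 / 2) ^ length \<sigma>) \<le> (1 / 2 :: real) ^ i"
proof -
  let ?w = "\<lambda>s. \<bar>real_of_rat (l s) - real_of_rat (r s)\<bar>"
  \<comment> \<open>A common range of intervals for all strings of \<open>F\<close>, so that the two
    sums can be swapped.\<close>
  obtain m where m: "length \<sigma> \<le> m" if "\<sigma> \<in> F" for \<sigma>
    using finite_nat_set_iff_bounded_le[of "length ` F"] F(1) by auto
  have "2 ^ (i + c) * (1 / 2) ^ length \<sigma> \<le> (\<Sum>s<m. of_bool (inside s \<sigma>) * (1 / 2) ^ length \<sigma> :: real)"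
    if "\<sigma> \<in> F" for \<sigma>
  proof -
    have "2 ^ (i + c) \<le> (\<Sum>s<length \<sigma>. of_bool (inside s \<sigma>) :: nat)"
      using that F(2) by (auto simp: test_def heavy_def)
    also have "\<dots> \<le> (\<Sum>s<m. of_bool (inside s \<sigma>))"
      using m[OF that] by (intro sum_mono2) auto
    finally have "real (2 ^ (i + c)) \<le> real (\<Sum>s<m. of_bool (inside s \<sigma>))"
      by (simp only: of_nat_le_iff)
    then have "2 ^ (i + c) \<le> (\<Sum>s<m. of_bool (inside s \<sigma>) :: real)"
      by simp
    then show ?thesis
      unfolding sum_distrib_right[symmetric] by (rule mult_right_mono) simp
  qed
  then have "2 ^ (i + c) * (\<Sum>\<sigma>\<in>F. (1 / 2) ^ length \<sigma>) \<le>
      (\<Sum>\<sigma>\<in>F. \<Sum>s<m. of_bool (inside s \<sigma>) * (1 / 2) ^ length \<sigma> :: real)"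
    unfolding sum_distrib_left by (rule sum_mono)
  also have "\<dots> = (\<Sum>s<m. \<Sum>\<sigma>\<in>F. of_bool (inside s \<sigma>) * (1 / 2) ^ length \<sigma>)"
    by (rule sum.swap)
  also have "\<dots> \<le> (\<Sum>s<m. ?w s)"
    by (intro sum_mono sum_inside_le F prefix_free_subset[OF prefix_free_test F(2)])
  also have "\<dots> \<le> (\<Sum>s. ?w s)"
    by (intro sum_le_suminf summable) auto
  also note total
  finally show ?thesis
    by (simp add: power_add power_one_over field_simps)
qed

text \<open>The predicate \<open>inside\<close> on codes: \<open>j - 2 ^ code_length j\<close>
  stands for \<open>string_value\<close>, and all comparisons are rational, so the closure rules
  apply.\<close>

definition inside_code :: "nat \<Rightarrow> nat \<Rightarrow> bool" where
  "inside_code s j \<longleftrightarrow>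
     l s \<le> of_nat (j - 2 ^ code_length j) * (1 / 2) ^ code_length j \<and>
     of_nat (Suc (j - 2 ^ code_length j)) * (1 / 2) ^ code_length j \<le> r s \<or>
     r s \<le> of_nat (j - 2 ^ code_length j) * (1 / 2) ^ code_length j \<and>
     of_nat (Suc (j - 2 ^ code_length j)) * (1 / 2) ^ code_length j \<le> l s"

lemma inside_code_string_code: "inside_code s (string_code \<sigma>) \<longleftrightarrow> inside s \<sigma>"
  unfolding inside_code_def inside_def dyadic_inside_of_rat_iff code_length_string_code
    string_value_def[symmetric] ..

definition heavy_code :: "nat \<Rightarrow> nat \<Rightarrow> bool" where
  "heavy_code i j \<longleftrightarrow> 2 ^ (i + c) \<le> (\<Sum>s<code_length j. of_bool (inside_code s j) :: nat)"

lemma heavy_code_string_code: "heavy_code i (string_code \<sigma>) \<longleftrightarrow> heavy i \<sigma>"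
  by (simp add: heavy_code_def heavy_def inside_code_string_code)

lemma decidable_on_heavy_code:
  assumes "computable_on n f" "computable_on n g"
  shows "decidable_on n (\<lambda>xs. heavy_code (f xs) (g xs))"
  unfolding heavy_code_def inside_code_def
  by (intro computable_on_intros computable_on_code_length rat_computable_on_seq[OF computable_l]
      rat_computable_on_seq[OF computable_r] computable_on_tl[OF assms(1)] computable_on_tl[OF assms(2)] assms) simp_all

lemma uniformly_computable_test: "uniformly_computable test"
proof -
  \<comment> \<open>Halving a code drops the last digit of the string.\<close>
  have code: "heavy_code i (string_code \<sigma> div 2) \<longleftrightarrow> heavy i (butlast \<sigma>)" for i \<sigma>
  proof (cases \<sigma> rule: rev_cases)
    case Nil
    \<comment> \<open>Half of the code of the empty string is 0, which codes no string. The default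
      length 0 makes the count empty there, in agreement with
      \<open>butlast [] = []\<close>.\<close>
    have "code_length 0 = 0" unfolding code_length_def by (rule Least_equality) auto
    then show ?thesis using Nil by (simp add: heavy_code_def heavy_def)
  next
    case (snoc \<tau> b)
    then show ?thesis by (simp add: heavy_code_string_code)
  qed
  have "computable_on 2 (\<lambda>xs. of_bool (heavy_code (hd xs) (hd (tl xs)) \<and> \<not> heavy_code (hd xs) (hd (tl xs) div 2)))"
    by (intro computable_on_intros decidable_on_heavy_code computable_on_div) simp_all
  then obtain g where "recursive_fn 2 g" and
    "\<And>xs. length xs = 2 \<Longrightarrow> g xs =
       of_bool (heavy_code (hd xs) (hd (tl xs)) \<and> \<not> heavy_code (hd xs) (hd (tl xs) div 2))"
    unfolding computable_on_def by blast
  then show ?thesis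
    unfolding uniformly_computable_def
    by (intro exI[of _ g]) (simp add: heavy_code_string_code code test_def)
qed

lemma martin_loef_test_test: "martin_loef_test test"
  unfolding martin_loef_test_def
  by (intro conjI allI uniformly_computable_test prefix_free_test emeasure_cylinders_le sum_test_le) simp_all

text \<open>Among the intervals around \<open>x\<close> choose \<open>2 ^ (i + c)\<close> many. A
  long enough initial segment of \<open>x\<close> lies inside all of them and is heavy, and the
  shortest heavy initial segment belongs to the test.\<close>

lemma mem_cylinders_test:
  assumes x: "0 \<le> x" "x < 1"
    and inf: "\<exists>\<^sub>F s in sequentially. (real_of_rat (l s) < x \<and> x < real_of_rat (r s)) \<or>
      (real_of_rat (r s) < x \<and> x < real_of_rat (l s))" (is "\<exists>\<^sub>F s in sequentially. ?P s")
  shows "binary_expansion x \<in> cylinders (test i)"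
proof -
  let ?x = "\<lambda>n. map (binary_expansion x) [0..<n]"
  have "infinite {s. ?P s}"
    unfolding frequently_cofinite[symmetric] cofinite_eq_sequentially by (rule inf)
  then obtain T where T: "finite T" "card T = 2 ^ (i + c)" "T \<subseteq> {s. ?P s}"
    using infinite_arbitrarily_large[of _ "2 ^ (i + c)"] by blast
  \<comment> \<open>The bound \<open>s < n\<close> matters because a string of length
    \<open>n\<close> is only compared with the first \<open>n\<close> intervals.\<close>
  have "eventually (\<lambda>n. s < n \<and> inside s (?x n)) sequentially" if "s \<in> T" for s
  proof -
    have "eventually (\<lambda>n. inside s (?x n)) sequentially"
    proof -
      have "?P s" using T(3) that by blast
      then show ?thesis
      proof
        assume "real_of_rat (l s) < x \<and> x < real_of_rat (r s)"
        then have "eventually (\<lambda>n. dyadic_inside (?x n) (real_of_rat (l s)) (real_of_rat (r s))) sequentially"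
          by (intro eventually_dyadic_inside x) simp_all
        then show ?thesis by eventually_elim (simp add: inside_def)
      next
        assume "real_of_rat (r s) < x \<and> x < real_of_rat (l s)"
        then have "eventually (\<lambda>n. dyadic_inside (?x n) (real_of_rat (r s)) (real_of_rat (l s))) sequentially"
          by (intro eventually_dyadic_inside x) simp_all
        then show ?thesis by eventually_elim (simp add: inside_def)
      qed
    qed
    with eventually_gt_at_top[of s] show ?thesis
      by eventually_elim simp
  qed
  then have "eventually (\<lambda>n. \<forall>s\<in>T. s < n \<and> inside s (?x n)) sequentially"
    using T(1) by (simp add: eventually_ball_finite)
  then obtain n where n: "\<And>s. s \<in> T \<Longrightarrow> s < n \<and> inside s (?x n)"
    unfolding eventually_sequentially by blast
  have "card T = (\<Sum>s\<in>T. of_bool (inside s (?x n)))"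
    using n by simp
  also have "\<dots> \<le> (\<Sum>s<n. of_bool (inside s (?x n)))"
    by (rule sum_mono2) (use n in auto)
  finally have ex: "heavy i (?x n)"
    by (simp add: heavy_def T(2))
  define m where "m = (LEAST n. heavy i (?x n))"
  have m: "heavy i (?x m)"
    unfolding m_def by (rule LeastI) (rule ex)
  \<comment> \<open>The empty string has count 0, below every threshold, so the minimal segment has
    a proper predecessor.\<close>
  moreover have "m \<noteq> 0"
    using m by (intro notI) (simp add: heavy_def)
  then have "butlast (?x m) = ?x (m - 1)" "m - 1 < m"
    by (cases m; simp)+
  then have "\<not> heavy i (butlast (?x m))"
    unfolding m_def by (metis not_less_Least)
  ultimately have "?x m \<in> test i"
    unfolding test_def by blast
  moreover have "\<forall>j<length (?x m). binary_expansion x j = ?x m ! j"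
    by simp
  ultimately show ?thesis
    unfolding cylinders_def by blast
qed

end

lemma not_random_of_interval_cover:
  assumes "computable_rat_seq l" "computable_rat_seq r"
    and sum: "summable (\<lambda>s. \<bar>real_of_rat (l s) - real_of_rat (r s)\<bar>)"
    and "0 \<le> x" "x < 1"
    and "\<exists>\<^sub>F s in sequentially. (real_of_rat (l s) < x \<and> x < real_of_rat (r s)) \<or>
      (real_of_rat (r s) < x \<and> x < real_of_rat (l s))"
  shows "\<not> martin_loef_random x"
proof -
  obtain c where "(\<Sum>s. \<bar>real_of_rat (l s) - real_of_rat (r s)\<bar>) \<le> 2 ^ c"
    using real_arch_pow[of 2 "\<Sum>s. \<bar>real_of_rat (l s) - real_of_rat (r s)\<bar>"] by (auto intro: less_imp_le)
  then interpret interval_cover l r c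
    by unfold_locales (use assms in auto)
  show ?thesis
    using martin_loef_test_test mem_cylinders_test[OF assms(4-)]
    unfolding martin_loef_random_def by blast
qed

section \<open>Weakly speedable reals are not random\<close>

lemma frequently_less_of_liminf_le:
  fixes X :: "nat \<Rightarrow> ereal"
  assumes "liminf X \<le> x" "x < y"
  shows "\<exists>\<^sub>F s in sequentially. X s < y"
proof (rule ccontr)
  assume "\<not> ?thesis"
  then have "eventually (\<lambda>s. y \<le> X s) sequentially"
    by (simp add: not_frequently not_less)
  then have "y \<le> liminf X" by (rule Liminf_bounded)
  with assms show False by simp
qed

lemma liminf_le_of_frequently_le:
  fixes X :: "nat \<Rightarrow> ereal"
  assumes "\<exists>\<^sub>F s in sequentially. X s \<le> y"
  shows "liminf X \<le> y"
proof (rule ccontr)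
  assume "\<not> ?thesis"
  then have "eventually (\<lambda>s. y < X s) sequentially"
    by (intro less_LiminfD) simp
  with assms show False
    by (simp add: frequently_def not_le)
qed

lemma computable_rat_seq_compose:
  assumes "computable_rat_seq a" "computable f"
  shows "computable_rat_seq (\<lambda>s. a (f s))"
  using assms(2) by (intro computable_rat_seqI rat_computable_on_seq[OF assms(1)])
    (simp add: computable_iff_computable_on)

lemma computable_Suc: "computable Suc"
  unfolding computable_iff_computable_on by (intro computable_on_intros) simp

text \<open>The intervals between consecutive terms have total length equal to the variation of the
  sequence.\<close>

lemma not_random_of_frequently_crossed:
  assumes "computable_rat_seq a" "summable (\<lambda>s. \<bar>real_of_rat (a s) - real_of_rat (a (Suc s))\<bar>)"
    and "0 \<le> x" "x < 1"
    and "\<exists>\<^sub>F s in sequentially. (real_of_rat (a s) < x \<and> x < real_of_rat (a (Suc s))) \<or>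
      (real_of_rat (a (Suc s)) < x \<and> x < real_of_rat (a s))"
  shows "\<not> martin_loef_random x"
  using assms by (intro not_random_of_interval_cover[of a "\<lambda>s. a (Suc s)"])
    (auto intro: computable_rat_seq_compose computable_Suc)

text \<open>A rational term never equals \<open>x\<close>, so every change of side is a crossing.
  Stating this for computable sequences of bounded variation also covers the extrapolation below,
  which may leave the unit interval.\<close>

lemma eventually_same_side:
  assumes "martin_loef_random x"
    and "computable_rat_seq a" "summable (\<lambda>s. \<bar>real_of_rat (a s) - real_of_rat (a (Suc s))\<bar>)"
    and "0 \<le> x" "x < 1" "x \<notin> \<rat>"
  shows "eventually (\<lambda>s. real_of_rat (a s) < x \<longleftrightarrow> real_of_rat (a (Suc s)) < x) sequentially"
proof -
  have ne: "real_of_rat (a s) \<noteq> x" for s using assms(6) by auto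
  have "\<not> (\<exists>\<^sub>F s in sequentially. (real_of_rat (a s) < x \<and> x < real_of_rat (a (Suc s))) \<or>
      (real_of_rat (a (Suc s)) < x \<and> x < real_of_rat (a s)))"
    using not_random_of_frequently_crossed[OF assms(2-5)] assms(1) by blast
  then show ?thesis
    unfolding not_frequently
    by (rule eventually_mono) (use ne in \<open>metis linorder_neqE\<close>)
qed

lemma dce_approximationD:
  assumes "dce_approximation a x"
  shows "computable_rat_seq a" "(\<lambda>s. real_of_rat (a s)) \<longlonglongrightarrow> x"
    "summable (\<lambda>s. \<bar>real_of_rat (a s) - real_of_rat (a (Suc s))\<bar>)"
    "0 \<le> a s" "a s \<le> 1"
  using assms unfolding dce_approximation_def approximation_def by auto

lemma not_random_of_rat:
  assumes "0 \<le> x" "x < 1" "x \<in> \<rat>"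
  shows "\<not> martin_loef_random x"
proof -
  obtain q where q: "x = real_of_rat q" using assms(3) by (auto elim: Rats_cases)
  \<comment> \<open>Intervals around the rational number itself, shrinking geometrically.\<close>
  have rat: "computable_rat_seq (\<lambda>s. q - (1 / 2) ^ s)" "computable_rat_seq (\<lambda>s. q + (1 / 2) ^ s)"
    by (intro computable_rat_seqI computable_on_intros; simp)+
  have diff: "\<bar>real_of_rat (q - (1 / 2) ^ s) - real_of_rat (q + (1 / 2) ^ s)\<bar> = 2 * (1 / 2) ^ s" for s
    by (simp add: of_rat_diff of_rat_add of_rat_power of_rat_divide)
  show ?thesis
  proof (rule not_random_of_interval_cover[OF rat _ assms(1,2)])
    show "summable (\<lambda>s. \<bar>real_of_rat (q - (1 / 2) ^ s) - real_of_rat (q + (1 / 2) ^ s)\<bar>)"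
      unfolding diff by (intro summable_mult summable_geometric) simp
  qed (simp add: q of_rat_less)
qed

text \<open>The two sequences enclose \<open>x\<close> from some stage on, which makes
  \<open>x\<close> computable: waiting until they are close gives enclosing intervals of summable
  length.\<close>

lemma not_random_of_opposite_sides:
  assumes a: "computable_rat_seq a" "(\<lambda>s. real_of_rat (a s)) \<longlonglongrightarrow> x"
    and r: "computable_rat_seq r" "(\<lambda>s. real_of_rat (r s)) \<longlonglongrightarrow> x"
    and x: "0 \<le> x" "x < 1"
    and opp: "eventually (\<lambda>s. (real_of_rat (a s) < x \<and> x < real_of_rat (r s)) \<or>
      (real_of_rat (r s) < x \<and> x < real_of_rat (a s))) sequentially"
  shows "\<not> martin_loef_random x"
proof -
  \<comment> \<open>The clause \<open>k \<le> s\<close> forces the search results to infinity, into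
    the range where the sequences enclose \<open>x\<close>. The two inequalities together bound the
    absolute value.\<close>
  define P where "P k s \<longleftrightarrow> k \<le> s \<and> a s - r s < (1 / 2) ^ k \<and> r s - a s < (1 / 2) ^ k" for k s
  define t where "t k = (LEAST s. P k s)" for k
  have ex: "\<exists>s. P k s" for k
  proof -
    have "(\<lambda>s. real_of_rat (a s - r s)) \<longlonglongrightarrow> 0"
      using tendsto_diff[OF a(2) r(2)] by (simp add: of_rat_diff)
    then have "eventually (\<lambda>s. dist (real_of_rat (a s - r s)) 0 < (1 / 2) ^ k) sequentially"
      by (rule tendstoD) simp
    with eventually_ge_at_top[of k] have "eventually (\<lambda>s. P k s) sequentially"
    proof eventually_elim
      case (elim s)
      then have "\<bar>real_of_rat (a s - r s)\<bar> < real_of_rat ((1 / 2) ^ k)"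
        by (simp add: of_rat_power of_rat_divide)
      then have "\<bar>a s - r s\<bar> < (1 / 2) ^ k"
        unfolding abs_less_iff of_rat_minus[symmetric] of_rat_less by blast
      with elim show ?case unfolding P_def by linarith
    qed
    then show ?thesis unfolding eventually_sequentially by blast
  qed
  have P: "P k (t k)" for k unfolding t_def by (rule LeastI_ex[OF ex])
  have "computable t"
    unfolding computable_iff_computable_on t_def
    by (rule computable_on_Least)
      (unfold P_def, intro computable_on_intros rat_computable_on_seq[OF a(1)] rat_computable_on_seq[OF r(1)],
        use ex[unfolded P_def] in simp_all)
  then have comp: "computable_rat_seq (\<lambda>k. a (t k))" "computable_rat_seq (\<lambda>k. r (t k))"
    using computable_rat_seq_compose a(1) r(1) by blast+
  show ?thesis
  proof (rule not_random_of_interval_cover[OF comp _ x])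
    have "\<bar>real_of_rat (a (t k)) - real_of_rat (r (t k))\<bar> \<le> (1 / 2) ^ k" for k
    proof -
      have "real_of_rat (a (t k) - r (t k)) < real_of_rat ((1 / 2) ^ k)"
        "real_of_rat (r (t k) - a (t k)) < real_of_rat ((1 / 2) ^ k)"
        using P[of k] by (simp_all only: P_def of_rat_less)
      then show ?thesis
        by (simp add: of_rat_power of_rat_divide of_rat_diff)
    qed
    then show "summable (\<lambda>k. \<bar>real_of_rat (a (t k)) - real_of_rat (r (t k))\<bar>)"
      by (intro summable_comparison_test'[OF summable_geometric[of "1/2"], of 0]) simp_all
    have "filterlim t at_top sequentially"
      by (rule filterlim_at_top_mono[OF filterlim_ident]) (use P in \<open>simp add: P_def\<close>)
    then show "\<exists>\<^sub>F k in sequentially. (real_of_rat (a (t k)) < x \<and> x < real_of_rat (r (t k))) \<or>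
      (real_of_rat (r (t k)) < x \<and> x < real_of_rat (a (t k)))"
      by (intro eventually_frequently sequentially_bot eventually_compose_filterlim[OF opp])
  qed
qed

lemma weakly_dce_speedable_imp_not_random:
  assumes x: "0 \<le> x" "x < 1" and weak: "weakly_dce_speedable x"
  shows "\<not> martin_loef_random x"
proof (cases "x \<in> \<rat>")
  case True
  then show ?thesis using not_random_of_rat x by blast
next
  case False
  show ?thesis
  proof
    assume rnd: "martin_loef_random x"
    obtain \<rho> :: rat and a b where \<rho>: "0 < \<rho>" "\<rho> < 1"
      and a: "dce_approximation a x" and b: "dce_approximation b x"
      and lim: "liminf (\<lambda>s. ereal \<bar>(x - real_of_rat (b s)) / (x - real_of_rat (a s))\<bar>) \<le> ereal (real_of_rat \<rho>)"
      using weak unfolding weakly_dce_speedable_def by blast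
    \<comment> \<open>Room above \<rho>: the quotient is below \<theta> infinitely often even if the
      limit inferior equals \<rho>.\<close>
    obtain \<theta> where \<theta>: "\<rho> < \<theta>" "\<theta> < 1" using dense[OF \<rho>(2)] by blast
    \<comment> \<open>When the quotient is below \<theta>, the move from \<open>a s\<close> to
      \<open>b s\<close> covers more than the fraction \<open>1 - \<theta>\<close> of the way to
      \<open>x\<close>. Stretching it by \<open>C\<close> therefore passes \<open>x\<close>.\<close>
    define C where "C = 1 / (1 - \<theta>)"
    define r where "r s = a s + C * (b s - a s)" for s
    have r_real: "real_of_rat (r s) = real_of_rat (a s) + real_of_rat C * (real_of_rat (b s) - real_of_rat (a s))" for s
      by (simp add: r_def of_rat_add of_rat_mult of_rat_diff)
    have C: "0 < real_of_rat C" "real_of_rat C * (1 - real_of_rat \<theta>) = 1"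
      using \<theta> by (simp_all add: C_def of_rat_divide of_rat_diff)
    have r: "computable_rat_seq r"
      unfolding r_def
      by (intro computable_rat_seqI computable_on_intros rat_computable_on_seq[OF dce_approximationD(1)[OF a]]
          rat_computable_on_seq[OF dce_approximationD(1)[OF b]]) simp_all
    have r_lim: "(\<lambda>s. real_of_rat (r s)) \<longlonglongrightarrow> x"
    proof -
      have "(\<lambda>s. real_of_rat (r s)) \<longlonglongrightarrow> x + real_of_rat C * (x - x)"
        unfolding r_real by (intro tendsto_intros dce_approximationD(2)[OF a] dce_approximationD(2)[OF b])
      then show ?thesis by simp
    qed
    \<comment> \<open>\<open>r\<close> is the combination of \<open>a\<close> and \<open>b\<close>
      with coefficients \<open>1 - C\<close> and \<open>C\<close>, so bounded variation carries
      over.\<close>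
    have r_var: "summable (\<lambda>s. \<bar>real_of_rat (r s) - real_of_rat (r (Suc s))\<bar>)"
    proof (rule summable_comparison_test')
      let ?va = "\<lambda>s. \<bar>real_of_rat (a s) - real_of_rat (a (Suc s))\<bar>"
      let ?vb = "\<lambda>s. \<bar>real_of_rat (b s) - real_of_rat (b (Suc s))\<bar>"
      show "summable (\<lambda>s. \<bar>1 - real_of_rat C\<bar> * ?va s + real_of_rat C * ?vb s)"
        by (intro summable_add summable_mult dce_approximationD(3)[OF a] dce_approximationD(3)[OF b])
      fix s
      have "real_of_rat (r s) - real_of_rat (r (Suc s)) =
          (1 - real_of_rat C) * (real_of_rat (a s) - real_of_rat (a (Suc s))) +
          real_of_rat C * (real_of_rat (b s) - real_of_rat (b (Suc s)))"
        by (simp add: r_real algebra_simps)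
      also have "\<bar>\<dots>\<bar> \<le> \<bar>1 - real_of_rat C\<bar> * ?va s + real_of_rat C * ?vb s"
        using C(1) by (intro order_trans[OF abs_triangle_ineq]) (simp add: abs_mult)
      finally show "norm \<bar>real_of_rat (r s) - real_of_rat (r (Suc s))\<bar> \<le>
          \<bar>1 - real_of_rat C\<bar> * ?va s + real_of_rat C * ?vb s"
        by simp
    qed
    txt \<open>If \<open>b s\<close> is closer to \<open>x\<close> than \<open>a s\<close> by the factor \<open>\<theta>\<close>, then the extrapolation \<open>r s\<close> overshoots
      \<open>x\<close>.\<close>
    let ?opp = "\<lambda>s. (real_of_rat (a s) < x \<and> x < real_of_rat (r s)) \<or>
      (real_of_rat (r s) < x \<and> x < real_of_rat (a s))"
    have ne: "real_of_rat q \<noteq> x" for q using False by auto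
    have "\<exists>\<^sub>F s in sequentially. ereal \<bar>(x - real_of_rat (b s)) / (x - real_of_rat (a s))\<bar> < ereal (real_of_rat \<theta>)"
      by (rule frequently_less_of_liminf_le[OF lim]) (use \<theta> in \<open>simp add: of_rat_less\<close>)
    then have freq: "\<exists>\<^sub>F s in sequentially. ?opp s"
    proof (rule frequently_elim1)
      fix s
      assume "ereal \<bar>(x - real_of_rat (b s)) / (x - real_of_rat (a s))\<bar> < ereal (real_of_rat \<theta>)"
      then have less: "\<bar>x - real_of_rat (b s)\<bar> < real_of_rat \<theta> * \<bar>x - real_of_rat (a s)\<bar>"
        using ne[of "a s"] by (simp add: abs_divide divide_less_eq)
      have "real_of_rat C * ((1 - real_of_rat \<theta>) * \<bar>x - real_of_rat (a s)\<bar>) = \<bar>x - real_of_rat (a s)\<bar>"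
        unfolding mult.assoc[symmetric] C(2) by simp
      moreover have "real_of_rat C * ((1 - real_of_rat \<theta>) * \<bar>x - real_of_rat (a s)\<bar>) <
          real_of_rat C * (\<bar>x - real_of_rat (a s)\<bar> - \<bar>x - real_of_rat (b s)\<bar>)"
        using less C(1) by (intro mult_strict_left_mono) (simp_all add: algebra_simps)
      ultimately have *: "\<bar>x - real_of_rat (a s)\<bar> < real_of_rat C * (\<bar>x - real_of_rat (a s)\<bar> - \<bar>x - real_of_rat (b s)\<bar>)"
        by (simp only:)
      show "?opp s"
      proof (cases "real_of_rat (a s) < x")
        case True
        then have "real_of_rat C * (\<bar>x - real_of_rat (a s)\<bar> - \<bar>x - real_of_rat (b s)\<bar>) \<le>
            real_of_rat C * (real_of_rat (b s) - real_of_rat (a s))"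
          using C(1) by (intro mult_left_mono) auto
        with * True show ?thesis unfolding r_real by linarith
      next
        case False
        with ne[of "a s"] have gt: "x < real_of_rat (a s)" by simp
        then have "real_of_rat C * (\<bar>x - real_of_rat (a s)\<bar> - \<bar>x - real_of_rat (b s)\<bar>) \<le>
            real_of_rat C * (real_of_rat (a s) - real_of_rat (b s))"
          using C(1) by (intro mult_left_mono) auto
        also have "\<dots> = - (real_of_rat C * (real_of_rat (b s) - real_of_rat (a s)))"
          by (simp add: algebra_simps)
        finally show ?thesis using * gt unfolding r_real by linarith
      qed
    qed
    \<comment> \<open>By randomness each of \<open>a\<close> and \<open>r\<close> stays on its own
      side of \<open>x\<close> from \<open>n\<close> on.\<close>
    obtain n where n: "\<And>s. n \<le> s \<Longrightarrow> real_of_rat (a s) < x \<longleftrightarrow> real_of_rat (a (Suc s)) < x"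
        "\<And>s. n \<le> s \<Longrightarrow> real_of_rat (r s) < x \<longleftrightarrow> real_of_rat (r (Suc s)) < x"
      using eventually_conj[OF eventually_same_side[OF rnd dce_approximationD(1,3)[OF a] x False]
          eventually_same_side[OF rnd r r_var x False]]
      unfolding eventually_sequentially by blast
    \<comment> \<open>A single later stage with opposite sides now fixes opposite sides for
      good.\<close>
    obtain m where m: "n \<le> m" "?opp m"
      using freq unfolding frequently_sequentially by blast
    have opp_iff: "?opp s \<longleftrightarrow> (real_of_rat (a s) < x) \<noteq> (real_of_rat (r s) < x)" for s
      using ne[of "a s"] ne[of "r s"] by linarith
    have "?opp s" if "m \<le> s" for s
      using that
    proof (induction s rule: dec_induct)
      case base
      show ?case by (rule m)
    next
      case (step s)
      then show ?case unfolding opp_iff using n[of s] m(1) by simp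
    qed
    then have "eventually ?opp sequentially"
      unfolding eventually_sequentially by blast
    from not_random_of_opposite_sides[OF dce_approximationD(1,2)[OF a] r r_lim x this] rnd
    show False by contradiction
  qed
qed

section \<open>From strong to weak speedability\<close>

lemma computable_rat_seq_const: "computable_rat_seq (\<lambda>_. q)"
  by (intro computable_rat_seqI rat_computable_on_const)

lemma dce_approximation_const:
  assumes "0 \<le> q" "q \<le> 1"
  shows "dce_approximation (\<lambda>_. q) (real_of_rat q)"
  using assms by (simp add: dce_approximation_def approximation_def computable_rat_seq_const)

text \<open>As \<open>f\<close> is nondecreasing, the steps of the reindexed sequence span disjoint
  blocks of steps of \<open>a\<close>, and the triangle inequality bounds each by the variation over
  its block.\<close>

lemma dce_approximation_compose:
  assumes a: "dce_approximation a x" and f: "computable_order f"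
  shows "dce_approximation (\<lambda>s. a (f s)) x"
proof -
  let ?a = "\<lambda>s. real_of_rat (a s)"
  have mono: "mono f" and comp: "computable f" and unbounded: "\<And>n. \<exists>s. n \<le> f s"
    using f by (auto simp: computable_order_def)
  have "filterlim f at_top sequentially"
    unfolding filterlim_at_top eventually_sequentially
    using unbounded mono by (meson monoD order_trans)
  then have "(\<lambda>s. ?a (f s)) \<longlonglongrightarrow> x"
    by (rule filterlim_compose[OF dce_approximationD(2)[OF a]])
  moreover have "summable (\<lambda>s. \<bar>?a (f s) - ?a (f (Suc s))\<bar>)"
  proof (rule summableI_nonneg_bounded)
    let ?v = "\<lambda>k. \<bar>?a k - ?a (Suc k)\<bar>"
    have step: "\<bar>?a p - ?a q\<bar> + (\<Sum>k<p. ?v k) \<le> (\<Sum>k<q. ?v k)" if "p \<le> q" for p q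
      using that
    proof (induction q rule: dec_induct)
      case (step q)
      then show ?case by simp
    qed simp
    fix n
    have "(\<Sum>s<n. \<bar>?a (f s) - ?a (f (Suc s))\<bar>) \<le> (\<Sum>k<f n. ?v k)"
    proof (induction n)
      case 0
      show ?case by (simp add: sum_nonneg)
    next
      case (Suc n)
      then show ?case using step[of "f n" "f (Suc n)"] monoD[OF mono, of n "Suc n"] by simp
    qed
    also have "\<dots> \<le> (\<Sum>k. ?v k)"
      by (intro sum_le_suminf dce_approximationD(3)[OF a]) auto
    finally show "(\<Sum>s<n. \<bar>?a (f s) - ?a (f (Suc s))\<bar>) \<le> (\<Sum>k. ?v k)" .
  qed simp
  ultimately show ?thesis
    using a computable_rat_seq_compose[OF dce_approximationD(1)[OF a] comp]
    by (simp add: dce_approximation_def approximation_def)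
qed

lemma strongly_imp_dce_speedable:
  assumes "strongly_dce_0_speedable x"
  shows "dce_speedable x"
proof -
  have "computable_order (\<lambda>s. s + 1)"
    using computable_Suc by (auto simp: computable_order_def mono_def intro: le_SucI)
  then show ?thesis
    using assms unfolding strongly_dce_0_speedable_def dce_speedable_def speedable_def rho_speedable_def
    by (metis order_refl zero_less_one)
qed

text \<open>The second approximation is the sped-up one, \<open>a (f s)\<close>.\<close>

lemma dce_speedable_imp_weakly:
  assumes x: "0 \<le> x" "x \<le> 1" and "dce_speedable x"
  shows "weakly_dce_speedable x"
proof (cases "x \<in> \<rat>")
  case True
  then obtain q where q: "x = real_of_rat q" by (auto elim: Rats_cases)
  then have "dce_approximation (\<lambda>_. q) x"
    using x dce_approximation_const[of q] by simp
  \<comment> \<open>All quotients are \<open>0 / 0\<close>, which has the value 0.\<close>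
  moreover have "liminf (\<lambda>s. ereal \<bar>(x - real_of_rat q) / (x - real_of_rat q)\<bar>) \<le> ereal (real_of_rat (1 / 2))"
    by (simp add: q Liminf_const of_rat_divide)
  ultimately show ?thesis
    unfolding weakly_dce_speedable_def
    by (intro exI[of _ "1 / 2"] conjI exI[of _ "\<lambda>_. q"]) simp_all
next
  case False
  then obtain a \<rho> f where a: "dce_approximation a x" and "0 \<le> \<rho>" "\<rho> < 1" and f: "computable_order f"
    and lim: "liminf (\<lambda>s. ereal \<bar>(x - real_of_rat (a (f s))) / (x - real_of_rat (a s))\<bar>) \<le> ereal (real_of_rat \<rho>)"
    using assms(3)
    unfolding dce_speedable_def speedable_def rho_speedable_def speedable_via_def by blast
  \<comment> \<open>Weak speedability asks for a positive bound, whereas \<rho> may be 0.\<close>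
  let ?\<rho> = "max \<rho> (1 / 2)"
  have "ereal (real_of_rat \<rho>) \<le> ereal (real_of_rat ?\<rho>)"
    by (simp add: of_rat_less_eq)
  with lim have "liminf (\<lambda>s. ereal \<bar>(x - real_of_rat (a (f s))) / (x - real_of_rat (a s))\<bar>) \<le> ereal (real_of_rat ?\<rho>)"
    by (rule order_trans)
  moreover have "0 < ?\<rho>" "?\<rho> < 1" using \<open>\<rho> < 1\<close> by auto
  ultimately show ?thesis
    unfolding weakly_dce_speedable_def using a dce_approximation_compose[OF a f] by blast
qed

section \<open>Detours\<close>

text \<open>Every term occurs twice. This bounds the variation of two interleaved sequences.\<close>

lemma summable_div_2:
  fixes f :: "nat \<Rightarrow> real"
  assumes "summable f" "\<And>n. 0 \<le> f n"
  shows "summable (\<lambda>n. f (n div 2))"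
proof (rule summableI_nonneg_bounded)
  fix n
  have "(\<Sum>k<2 * n. f (k div 2)) = 2 * (\<Sum>k<n. f k)"
    by (induction n) simp_all
  moreover have "(\<Sum>k<n. f (k div 2)) \<le> (\<Sum>k<2 * n. f (k div 2))"
    by (rule sum_mono2) (use assms in auto)
  moreover have "(\<Sum>k<n. f k) \<le> suminf f"
    using assms by (intro sum_le_suminf) auto
  ultimately show "(\<Sum>k<n. f (k div 2)) \<le> 2 * suminf f" by linarith
qed (rule assms)

text \<open>The witness alternates between a detour point and \<open>a n\<close>. When
  \<open>a n\<close> is very close to \<open>x\<close> relative to \<open>d n\<close>, the return
  step divides the distance to \<open>x\<close> by a large factor, so the limit inferior is
  0.\<close>

lemma strongly_dce_0_speedable_of_detours:
  assumes a: "dce_approximation a x" and irr: "x \<notin> \<rat>"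
    and comp: "computable_rat_seq d" and d: "\<And>n. 0 \<le> d n" "\<And>n. d n \<le> 1 / 2"
    and sum: "summable (\<lambda>n. real_of_rat (d n))"
    and freq: "\<And>e. 0 < e \<Longrightarrow> \<exists>\<^sub>F n in sequentially. \<bar>x - real_of_rat (a n)\<bar> \<le> e * real_of_rat (d n)"
  shows "strongly_dce_0_speedable x"
proof -
  \<comment> \<open>The detour goes away from the nearer end of the unit interval. Since
    \<open>d n \<le> 1 / 2\<close>, it stays inside.\<close>
  define b where "b n = (if a n \<le> 1 / 2 then a n + d n else a n - d n)" for n
  \<comment> \<open>The equation \<open>s = s div 2 * 2\<close> expresses evenness by computable
    operations.\<close>
  define c where "c s = (if s = s div 2 * 2 then b (s div 2) else a (s div 2))" for s
  have c_even: "c (2 * n) = b n" and c_odd: "c (Suc (2 * n)) = a n" for n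
    by (simp_all add: c_def)
  have c_comp: "computable_rat_seq c"
    unfolding c_def b_def
    by (intro computable_rat_seqI computable_on_intros rat_computable_on_seq[OF comp]
        rat_computable_on_seq[OF dce_approximationD(1)[OF a]] computable_on_div) simp_all
  have b01: "0 \<le> b n" "b n \<le> 1" for n
    using dce_approximationD(4,5)[OF a, of n] d[of n] by (auto simp: b_def)
  have dist_ab: "\<bar>real_of_rat (a n) - real_of_rat (b n)\<bar> = real_of_rat (d n)" for n
    using d(1)[of n] by (simp add: b_def of_rat_add of_rat_diff)
  have d_lim: "(\<lambda>n. real_of_rat (d n)) \<longlonglongrightarrow> 0"
    by (rule summable_LIMSEQ_zero[OF sum])
  have "(\<lambda>n. real_of_rat (a n) - real_of_rat (b n)) \<longlonglongrightarrow> 0"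
    using d_lim by (subst tendsto_rabs_zero_iff[symmetric]) (simp add: dist_ab)
  from tendsto_diff[OF dce_approximationD(2)[OF a] this]
  have b_lim: "(\<lambda>n. real_of_rat (b n)) \<longlonglongrightarrow> x" by simp
  have div_top: "filterlim (\<lambda>s::nat. s div 2) at_top sequentially"
    unfolding filterlim_at_top eventually_sequentially
    by (metis div_le_mono nonzero_mult_div_cancel_left zero_neq_numeral)
  have "(\<lambda>s. real_of_rat (c s)) \<longlonglongrightarrow> x"
  proof (rule tendstoI)
    fix e :: real assume "0 < e"
    then have "eventually (\<lambda>n. dist (real_of_rat (a n)) x < e \<and> dist (real_of_rat (b n)) x < e) sequentially"
      by (intro eventually_conj tendstoD[OF b_lim] tendstoD[OF dce_approximationD(2)[OF a]])
    from eventually_compose_filterlim[OF this div_top]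
    show "eventually (\<lambda>s. dist (real_of_rat (c s)) x < e) sequentially"
      by eventually_elim (simp add: c_def)
  qed
  moreover have "summable (\<lambda>s. \<bar>real_of_rat (c s) - real_of_rat (c (Suc s))\<bar>)"
  proof (rule summable_comparison_test')
    \<comment> \<open>The first summand is the return from \<open>b n\<close> to \<open>a n\<close>;
      the others bound the step from \<open>a n\<close> to \<open>b (Suc n)\<close> through
      \<open>a (Suc n)\<close>.\<close>
    let ?F = "\<lambda>n. real_of_rat (d n) + (\<bar>real_of_rat (a n) - real_of_rat (a (Suc n))\<bar> + real_of_rat (d (Suc n)))"
    have "summable ?F"
      using summable_Suc_iff[of "\<lambda>n. real_of_rat (d n)"]
      by (intro summable_add sum dce_approximationD(3)[OF a]) (simp add: sum)
    then show "summable (\<lambda>s. ?F (s div 2))"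
      by (rule summable_div_2) (use d(1) in simp)
    fix s :: nat
    show "norm \<bar>real_of_rat (c s) - real_of_rat (c (Suc s))\<bar> \<le> ?F (s div 2)"
    proof (cases "even s")
      case True
      then obtain n where s: "s = 2 * n" by (auto elim: evenE)
      show ?thesis
        using dist_ab[of n] d(1)[of n] d(1)[of "Suc n"]
        by (simp add: s c_even c_odd abs_minus_commute)
    next
      case False
      then obtain n where s: "s = Suc (2 * n)" by (auto elim: oddE)
      have "c (Suc s) = b (Suc n)" using c_even[of "Suc n"] by (simp add: s)
      moreover have "s div 2 = n" "c s = a n" by (simp_all add: s c_odd)
      moreover have "0 \<le> real_of_rat (d n)" using d(1) by simp
      then have "\<bar>real_of_rat (a n) - real_of_rat (b (Suc n))\<bar> \<le> ?F n"
        using dist_ab[of "Suc n"] by linarith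
      ultimately show ?thesis by (simp only: real_norm_def abs_abs)
    qed
  qed
  moreover have "0 \<le> c s" "c s \<le> 1" for s
    using b01 dce_approximationD(4,5)[OF a] by (simp_all add: c_def)
  ultimately have c: "dce_approximation c x"
    using c_comp by (simp only: dce_approximation_def approximation_def simp_thms)
  have "liminf (\<lambda>s. ereal \<bar>(x - real_of_rat (c (s + 1))) / (x - real_of_rat (c s))\<bar>) \<le> ereal e"
    if "0 < e" for e
  proof (rule liminf_le_of_frequently_le)
    \<comment> \<open>The bound \<open>e' \<le> 1 / 2\<close> keeps \<open>b n\<close> at distance
      at least \<open>d n / 2\<close> from \<open>x\<close>, and \<open>2 * e' \<le> e\<close>
      absorbs this loss of a factor 2.\<close>
    define e' where "e' = min e 1 / 2"
    have e': "0 < e'" "e' \<le> 1 / 2" "2 * e' \<le> e" using that by (auto simp: e'_def)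
    show "\<exists>\<^sub>F s in sequentially. ereal \<bar>(x - real_of_rat (c (s + 1))) / (x - real_of_rat (c s))\<bar> \<le> ereal e"
      unfolding frequently_sequentially
    proof
      fix m
      obtain n where n: "m \<le> n" "\<bar>x - real_of_rat (a n)\<bar> \<le> e' * real_of_rat (d n)"
        using freq[OF e'(1)] unfolding frequently_sequentially by blast
      have "e' * real_of_rat (d n) \<le> 1 / 2 * real_of_rat (d n)"
        using d(1)[of n] e'(2) by (intro mult_right_mono) simp_all
      then have "real_of_rat (d n) / 2 \<le> \<bar>x - real_of_rat (b n)\<bar>"
        using dist_ab[of n] n(2) by linarith
      then have "2 * e' * (real_of_rat (d n) / 2) \<le> e * \<bar>x - real_of_rat (b n)\<bar>"
        using e' d(1)[of n] that by (intro mult_mono) simp_all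
      with n(2) have "\<bar>x - real_of_rat (a n)\<bar> \<le> e * \<bar>x - real_of_rat (b n)\<bar>" by simp
      moreover have "x \<noteq> real_of_rat (b n)" using irr by auto
      ultimately have "\<bar>(x - real_of_rat (c (2 * n + 1))) / (x - real_of_rat (c (2 * n)))\<bar> \<le> e"
        by (simp add: c_even c_odd abs_divide divide_le_eq)
      with n(1) show "\<exists>s\<ge>m. ereal \<bar>(x - real_of_rat (c (s + 1))) / (x - real_of_rat (c s))\<bar> \<le> ereal e"
        by (intro exI[of _ "2 * n"] conjI) (simp_all only: ereal_less_eq trans_le_add1 mult_2)
    qed
  qed
  then have "liminf (\<lambda>s. ereal \<bar>(x - real_of_rat (c (s + 1))) / (x - real_of_rat (c s))\<bar>) \<le> ereal (real_of_rat 0)"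
    by - (rule ereal_le_epsilon2, simp)
  then show ?thesis
    unfolding strongly_dce_0_speedable_def speedable_via_def
    by (intro exI[of _ c] conjI disjI2 c irr)
qed

text \<open>Every pair of numbers is the pair of exponents of 2 and 3 of infinitely many \<open>n + 1\<close>. This
  replaces a computable pairing function.\<close>

definition factor_exponent :: "nat \<Rightarrow> nat \<Rightarrow> nat" where
  "factor_exponent p n = (LEAST e. \<not> p ^ Suc e dvd Suc n)"

lemma factor_exponent_eq:
  assumes "Suc n = p ^ e * m" "\<not> p dvd m" "0 < p"
  shows "factor_exponent p n = e"
  unfolding factor_exponent_def
proof (rule Least_equality)
  show "\<not> p ^ Suc e dvd Suc n"
    using assms by (simp add: mult.commute)
  show "e \<le> k" if "\<not> p ^ Suc k dvd Suc n" for k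
  proof (rule ccontr)
    assume "\<not> e \<le> k"
    then have "p ^ Suc k dvd p ^ e" by (intro le_imp_power_dvd) simp
    with that show False unfolding assms(1) by (simp add: dvd_mult2)
  qed
qed

lemma exists_factor_exponents: "\<exists>n\<ge>k. factor_exponent 2 n = i \<and> factor_exponent 3 n = j"
proof (intro exI conjI)
  \<comment> \<open>The power of 5 makes the number large without affecting the exponents of 2 and
    3. The subtraction matches \<open>Suc n\<close> in \<open>factor_exponent\<close>.\<close>
  let ?n = "2 ^ i * 3 ^ j * 5 ^ k - 1 :: nat"
  have "k < 5 ^ k" by (rule less_le_trans[OF less_exp]) (simp add: power_mono)
  also have "\<dots> \<le> 2 ^ i * 3 ^ j * 5 ^ k" by simp
  finally show "k \<le> ?n" by simp
  show "factor_exponent 2 ?n = i"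
    by (rule factor_exponent_eq[where m = "3 ^ j * 5 ^ k"]) (simp_all add: mult.assoc)
  have "\<not> 3 dvd m \<Longrightarrow> \<not> 3 dvd 2 * m" "\<not> 3 dvd m \<Longrightarrow> \<not> 3 dvd 5 * m" for m :: nat
    by presburger+
  then have "\<not> 3 dvd (2 ^ i * m)" if "\<not> 3 dvd m" for m :: nat
    using that by (induction i) (simp_all add: mult.assoc)
  moreover have "\<not> 3 dvd (5 ^ k :: nat)"
    using \<open>\<And>m. \<not> 3 dvd m \<Longrightarrow> \<not> 3 dvd 5 * m\<close> by (induction k) simp_all
  ultimately have "\<not> 3 dvd (2 ^ i * 5 ^ k :: nat)" by blast
  then show "factor_exponent 3 ?n = j"
    by (rule factor_exponent_eq[rotated]) (simp_all add: mult_ac)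
qed

lemma computable_on_factor_exponent:
  assumes "2 \<le> p" "computable_on n f"
  shows "computable_on n (\<lambda>xs. factor_exponent p (f xs))"
proof -
  \<comment> \<open>Divisibility as a bounded search for the cofactor, which is decidable.\<close>
  have dvd_iff: "m dvd Suc k \<longleftrightarrow> (\<exists>q<Suc (Suc k). Suc k = q * m)" for m k
  proof
    assume "m dvd Suc k"
    then obtain q where "Suc k = q * m" by (metis dvd_def mult.commute)
    moreover from this have "q * 1 \<le> q * m" by (intro mult_le_mono2) (cases m; simp)
    ultimately show "\<exists>q<Suc (Suc k). Suc k = q * m" 
      by (intro exI[of _ q]) (simp only: less_Suc_eq_le mult_1_right)
  qed (metis dvd_triv_right)
  \<comment> \<open>The search ends because \<open>p ^ Suc k\<close> exceeds \<open>Suc k\<close>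
    for \<open>p \<ge> 2\<close>.\<close>
  have ex: "\<exists>e. \<not> (\<exists>q<Suc (Suc k). Suc k = q * p ^ Suc e)" for k
  proof (rule exI[of _ k])
    have "Suc k < 2 ^ Suc k" by (rule less_exp)
    also have "\<dots> \<le> p ^ Suc k" using assms(1) by (rule power_mono) simp
    finally show "\<not> (\<exists>q<Suc (Suc k). Suc k = q * p ^ Suc k)"
      unfolding dvd_iff[symmetric] by (auto dest: dvd_imp_le)
  qed
  show ?thesis
    unfolding factor_exponent_def dvd_iff
  proof (rule computable_on_Least[OF _ ex])
    show "decidable_on (Suc n) (\<lambda>ys. \<not> (\<exists>q<Suc (Suc (f (tl ys))). Suc (f (tl ys)) = q * p ^ Suc (hd ys)))"
      by (intro computable_on_intros computable_on_tl[OF assms(2)]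
          computable_on_tl[OF computable_on_tl[OF assms(2)]]) simp_all
  qed
qed

lemma string_code_surj: "1 \<le> j \<Longrightarrow> \<exists>\<sigma>. string_code \<sigma> = j"
proof (induction j rule: less_induct)
  case (less j)
  show ?case
  proof (cases "j = 1")
    case True
    then show ?thesis by (intro exI[of _ "[]"]) simp
  next
    case False
    with less.prems have "j div 2 < j" "1 \<le> j div 2" by auto
    from less.IH[OF this] obtain \<sigma> where "string_code \<sigma> = j div 2" by blast
    then have "string_code (\<sigma> @ [odd j]) = j" by simp
    then show ?thesis by blast
  qed
qed

section \<open>Detours given by a Martin-Loef test\<close>

locale detours =
  fixes a :: "nat \<Rightarrow> rat" and x :: real and U :: "nat \<Rightarrow> bool list set" and g :: "nat list \<Rightarrow> nat"
  assumes a: "dce_approximation a x" and x: "0 \<le> x" "x < 1" "x \<notin> \<rat>"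
    and g: "recursive_fn 2 g" "\<And>i \<sigma>. g [i, string_code \<sigma>] = of_bool (\<sigma> \<in> U i)"
    and prefix_free: "\<And>i. prefix_free (U i)"
    and measure: "\<And>i. emeasure cantor_measure (cylinders (U i)) \<le> ennreal ((1 / 2) ^ i)"
    and covered: "\<And>i. binary_expansion x \<in> cylinders (U i)"
begin

text \<open>Stage \<open>n\<close> examines the string with code \<open>code n\<close> at level
  \<open>level n\<close>. Every such pair comes up at infinitely many stages.\<close>

definition level :: "nat \<Rightarrow> nat" where "level n = factor_exponent 2 n"
definition code :: "nat \<Rightarrow> nat" where "code n = factor_exponent 3 n"
definition len :: "nat \<Rightarrow> nat" where "len n = code_length (code n)"

text \<open>The value 0 codes no string, so it is excluded. The inequalities say that
  \<open>a n\<close> lies in the closed dyadic interval of the string.\<close>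

definition hit :: "nat \<Rightarrow> bool" where
  "hit n \<longleftrightarrow> 1 \<le> code n \<and> g [2 * level n + 2, code n] = 1 \<and>
     of_nat (code n - 2 ^ len n) * (1 / 2) ^ len n \<le> a n \<and> a n \<le> of_nat (Suc (code n - 2 ^ len n)) * (1 / 2) ^ len n"

text \<open>Charging each pair of level and string at most once turns the sum over stages into a sum
  over strings of the test.\<close>

definition first_hit :: "nat \<Rightarrow> bool" where
  "first_hit n \<longleftrightarrow> hit n \<and> \<not> (\<exists>m<n. level m = level n \<and> code m = code n \<and> hit m)"

text \<open>A string in \<open>U (2 * i + 2)\<close> has weight \<open>2 ^ (i + 1)\<close>: this keeps the total length of the detours
  finite, while a detour is \<open>2 ^ (i + 1)\<close> times longer than the interval that caused it.\<close>

definition detour :: "nat \<Rightarrow> rat" where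
  "detour n = (if first_hit n then of_nat (2 ^ (level n + 1)) * (1 / 2) ^ len n else 0)"

definition target :: "nat \<Rightarrow> bool list" where "target n = (SOME \<sigma>. string_code \<sigma> = code n)"

lemma computable_rat_seq_detour: "computable_rat_seq detour"
proof -
  have level: "computable_on n (\<lambda>xs. level (f xs))" and code: "computable_on n (\<lambda>xs. code (f xs))"
    if "computable_on n f" for n f
    unfolding level_def code_def by (intro computable_on_factor_exponent that; simp)+
  have len: "computable_on n (\<lambda>xs. len (f xs))" if "computable_on n f" for n f
    unfolding len_def by (intro computable_on_code_length code that)
  have hit: "decidable_on n (\<lambda>xs. hit (f xs))" if "computable_on n f" for n f
    unfolding hit_def
    by (intro computable_on_intros level code len rat_computable_on_seq[OF dce_approximationD(1)[OF a]]
        computable_on_compose_2[OF recursive_imp_computable_on[OF g(1)]] that)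
  show ?thesis
    unfolding detour_def first_hit_def
    by (intro computable_rat_seqI computable_on_intros level code len hit) simp_all
qed

lemma string_code_target: "hit n \<Longrightarrow> string_code (target n) = code n"
  unfolding target_def by (rule someI_ex, rule string_code_surj) (simp add: hit_def)

lemma target_mem:
  assumes "hit n"
  shows "target n \<in> U (2 * level n + 2)"
proof -
  have "g [2 * level n + 2, code n] = 1" using assms unfolding hit_def by (elim conjE)
  then show ?thesis unfolding string_code_target[OF assms, symmetric] g(2) by (simp only: of_bool_eq_1_iff)
qed

lemma len_eq:
  assumes "hit n"
  shows "len n = length (target n)"
  unfolding len_def string_code_target[OF assms, symmetric] by simp

lemma sum_U_le: "finite F \<Longrightarrow> F \<subseteq> U i \<Longrightarrow> (\<Sum>\<sigma>\<in>F. (1 / 2) ^ length \<sigma>) \<le> (1 / 2 :: real) ^ i"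
  by (rule sum_le_of_emeasure_cylinders_le[OF prefix_free measure]) simp_all

lemma real_of_rat_detour: "real_of_rat (detour n) = (if first_hit n then 2 ^ (level n + 1) * (1 / 2) ^ length (target n) else 0)"
  by (simp add: detour_def of_rat_mult of_rat_power of_rat_divide first_hit_def len_eq)

lemma detour_nonneg: "0 \<le> detour n"
  by (simp add: detour_def)

text \<open>The factor of level \<open>i\<close> times the measure bound for
  \<open>U (2 * i + 2)\<close>: the allowance of this level, summable over \<open>i\<close>.\<close>

lemma halves: "2 ^ (i + 1) * (1 / 2) ^ (2 * i + 2) = (1 / 2 :: real) ^ (i + 1)"
proof -
  have "(1 / 2 :: real) ^ (2 * i + 2) = (1 / 2) ^ (i + 1) * (1 / 2) ^ (i + 1)"
    unfolding power_add[symmetric] by (simp add: mult_2)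
  then show ?thesis
    by (simp only: mult.assoc[symmetric] power_mult_distrib[symmetric]) simp
qed

text \<open>A single string of the test already obeys the measure bound, so its interval is short
  enough for its level.\<close>

lemma detour_le: "detour n \<le> 1 / 2"
proof -
  have "real_of_rat (detour n) \<le> real_of_rat (1 / 2)"
  proof (cases "first_hit n")
    case True
    then have "(1 / 2 :: real) ^ length (target n) \<le> (1 / 2) ^ (2 * level n + 2)"
      using sum_U_le[of "{target n}" "2 * level n + 2"] target_mem by (simp add: first_hit_def)
    then have "real_of_rat (detour n) \<le> 2 ^ (level n + 1) * (1 / 2) ^ (2 * level n + 2)"
      using True unfolding real_of_rat_detour by (simp only: if_True) (rule mult_left_mono, simp_all)
    also have "\<dots> \<le> 1 / 2"
      unfolding halves by (simp add: power_le_one)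
    finally show ?thesis by (simp add: of_rat_divide)
  qed (simp add: detour_def)
  then show ?thesis by (simp only: of_rat_less_eq)
qed

text \<open>Grouped by level, the detours of level \<open>i\<close> total at most
  \<open>(1 / 2) ^ (i + 1)\<close>, by the measure bound on \<open>U (2 * i + 2)\<close>.\<close>

lemma summable_detour: "summable (\<lambda>n. real_of_rat (detour n))"
proof (rule summableI_nonneg_bounded)
  fix N
  define A where "A = {n \<in> {..<N}. first_hit n}"
  define B where "B = (\<lambda>n. (level n, target n)) ` A"
  define F where "F i = {\<sigma>. (i, \<sigma>) \<in> B}" for i
  define M where "M = Suc (Max (insert 0 (level ` A)))"
  have finB: "finite B" by (simp add: B_def A_def)
  have finF: "finite (F i)" for i
    using finite_vimageI[OF finB, of "Pair i"] by (simp add: F_def vimage_def inj_on_def)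
  have F: "F i \<subseteq> U (2 * i + 2)" for i
    using target_mem by (auto simp: F_def B_def A_def first_hit_def)
  have B: "B = Sigma {..<M} F"
    by (auto simp: F_def B_def M_def A_def less_Suc_eq_le intro!: Max_ge)
  \<comment> \<open>Equal targets have equal codes, so of two stages with the same pair the later
    one is not a first hit.\<close>
  have inj: "inj_on (\<lambda>n. (level n, target n)) A"
  proof (rule inj_onI)
    fix m n assume "m \<in> A" "n \<in> A" and eq: "(level m, target m) = (level n, target n)"
    then have *: "first_hit m" "first_hit n" by (auto simp: A_def)
    then have "code m = code n" using eq string_code_target unfolding first_hit_def by (metis prod.inject)
    with eq * show "m = n"
      unfolding first_hit_def by (metis linorder_neqE_nat prod.inject)
  qed
  have "(\<Sum>n<N. real_of_rat (detour n)) = (\<Sum>n\<in>A. 2 ^ (level n + 1) * (1 / 2) ^ length (target n))"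
    unfolding real_of_rat_detour A_def by (intro sum.mono_neutral_cong_right) auto
  also have "\<dots> = (\<Sum>(i, \<sigma>)\<in>B. 2 ^ (i + 1) * (1 / 2) ^ length \<sigma>)"
    unfolding B_def by (subst sum.reindex[OF inj]) simp
  also have "\<dots> = (\<Sum>i<M. \<Sum>\<sigma>\<in>F i. 2 ^ (i + 1) * (1 / 2) ^ length \<sigma>)"
    unfolding B by (rule sum.Sigma[symmetric]) (simp_all add: finF)
  also have "\<dots> \<le> (\<Sum>i<M. 2 ^ (i + 1) * (1 / 2) ^ (2 * i + 2))"
    unfolding sum_distrib_left[symmetric]
    by (intro sum_mono mult_left_mono sum_U_le finF F) simp
  also have "\<dots> = (\<Sum>i<M. 1 / 2 * (1 / 2) ^ i)"
    unfolding halves by simp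
  also have "\<dots> \<le> (\<Sum>i. 1 / 2 * (1 / 2) ^ i)"
    by (intro sum_le_suminf summable_mult summable_geometric) simp_all
  finally show "(\<Sum>n<N. real_of_rat (detour n)) \<le> (\<Sum>i. 1 / 2 * (1 / 2) ^ i)" .
qed (simp add: detour_nonneg)

text \<open>At the first hit of a test string around \<open>x\<close>, both \<open>x\<close> and
  \<open>a n\<close> lie in its interval, and the detour is \<open>2 ^ (i + 1)\<close> times as long
  as that interval.\<close>

lemma exists_good_detour: "\<exists>n. level n = i \<and> \<bar>x - real_of_rat (a n)\<bar> \<le> (1 / 2) ^ (i + 1) * real_of_rat (detour n)"
proof -
  obtain \<sigma> where \<sigma>: "\<sigma> \<in> U (2 * i + 2)" and fl: "\<lfloor>x * 2 ^ length \<sigma>\<rfloor> = int (string_value \<sigma>)"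
    using covered[of "2 * i + 2"] mem_cylinders_iff[OF x(1,2)] by blast
  let ?v = "string_value \<sigma>" and ?n = "length \<sigma>"
  let ?lo = "of_nat ?v * (1 / 2) ^ ?n :: rat" and ?hi = "of_nat (Suc ?v) * (1 / 2) ^ ?n :: rat"
  have real_lo: "real_of_rat ?lo = real ?v * (1 / 2) ^ ?n" and real_hi: "real_of_rat ?hi = (real ?v + 1) * (1 / 2) ^ ?n"
    by (simp_all add: of_rat_mult of_rat_power of_rat_divide of_rat_add add.commute)
  have "real ?v \<le> x * 2 ^ ?n" "x * 2 ^ ?n < real ?v + 1"
    using fl by (simp_all add: floor_eq_iff)
  then have "real_of_rat ?lo \<le> x" "x < real_of_rat ?hi"
    unfolding real_lo real_hi by (simp_all add: power_one_over pos_divide_le_eq pos_less_divide_eq)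
  \<comment> \<open>Irrationality puts \<open>x\<close> in the interior, so \<open>a\<close>
    eventually enters the interval and a hit occurs.\<close>
  moreover have "real_of_rat ?lo \<noteq> x" using x(3) by auto
  ultimately have lohi: "real_of_rat ?lo < x" "x < real_of_rat ?hi" by simp_all
  have "eventually (\<lambda>n. real_of_rat ?lo < real_of_rat (a n) \<and> real_of_rat (a n) < real_of_rat ?hi) sequentially"
    by (intro eventually_conj order_tendstoD[OF dce_approximationD(2)[OF a]] lohi)
  then obtain k where k: "?lo \<le> a n" "a n \<le> ?hi" if "k \<le> n" for n
    unfolding eventually_sequentially of_rat_less by (meson less_imp_le)
  obtain m where m: "k \<le> m" "level m = i" "code m = string_code \<sigma>"
    using exists_factor_exponents unfolding level_def code_def by blast
  have pos: "1 \<le> string_code \<sigma>"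
    using string_code_bounds(1)[of \<sigma>] by (rule order_trans[rotated]) simp
  have hit_iff: "hit n \<longleftrightarrow> ?lo \<le> a n \<and> a n \<le> ?hi" if "level n = i" "code n = string_code \<sigma>" for n
    unfolding hit_def len_def that using \<sigma> pos by (simp add: g(2) string_value_def)
  let ?P = "\<lambda>n. level n = i \<and> code n = string_code \<sigma> \<and> hit n"
  \<comment> \<open>The first hit may precede the stage \<open>k\<close>; being a hit already places
    \<open>a n\<close> in the interval.\<close>
  define n where "n = (LEAST n. ?P n)"
  have "?P m" using m k[OF m(1)] hit_iff by simp
  then have n: "?P n" unfolding n_def by (rule LeastI)
  have "\<not> ?P m" if "m < n" for m
    using that unfolding n_def by (rule not_less_Least)
  with n have "first_hit n" unfolding first_hit_def by metis
  moreover have len: "length (target n) = ?n"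
    using n len_eq[of n] by (simp add: len_def)
  ultimately have detour: "real_of_rat (detour n) = 2 ^ (i + 1) * (1 / 2) ^ ?n"
    using n by (simp add: real_of_rat_detour)
  have "real_of_rat ?lo \<le> real_of_rat (a n)" "real_of_rat (a n) \<le> real_of_rat ?hi"
    using n hit_iff[of n] by (simp_all only: of_rat_less_eq simp_thms)
  moreover have "real_of_rat ?hi = real_of_rat ?lo + (1 / 2) ^ ?n"
    unfolding real_lo real_hi by (simp add: algebra_simps)
  ultimately have "\<bar>x - real_of_rat (a n)\<bar> \<le> (1 / 2) ^ ?n"
    using lohi by linarith
  also have "\<dots> = (1 / 2) ^ (i + 1) * real_of_rat (detour n)"
    unfolding detour by (simp add: power_one_over)
  finally show ?thesis using n by blast
qed

lemma frequently_good_detour: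
  assumes "0 < e"
  shows "\<exists>\<^sub>F n in sequentially. \<bar>x - real_of_rat (a n)\<bar> \<le> e * real_of_rat (detour n)"
  unfolding frequently_sequentially
proof
  fix N
  obtain i0 where i0: "(1 / 2 :: real) ^ i0 < e"
    using real_arch_pow_inv[OF assms, of "1 / 2"] by auto
  \<comment> \<open>A level above all levels of stages before \<open>N\<close> forces the stage to
    be at least \<open>N\<close>; exceeding \<open>i0\<close> makes the ratio small enough.\<close>
  define i where "i = Suc (i0 + Max (insert 0 (level ` {..<N})))"
  obtain n where n: "level n = i" "\<bar>x - real_of_rat (a n)\<bar> \<le> (1 / 2) ^ (i + 1) * real_of_rat (detour n)"
    using exists_good_detour by blast
  have "N \<le> n"
  proof (rule ccontr)
    assume "\<not> N \<le> n"
    then have "level n \<le> Max (insert 0 (level ` {..<N}))" by (intro Max_ge) auto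
    with n(1) show False by (simp add: i_def)
  qed
  moreover have "(1 / 2 :: real) ^ (i + 1) \<le> (1 / 2) ^ i0"
    by (rule power_decreasing) (simp_all add: i_def)
  then have "(1 / 2) ^ (i + 1) * real_of_rat (detour n) \<le> e * real_of_rat (detour n)"
    using i0 by (intro mult_right_mono) (simp_all add: detour_nonneg)
  ultimately show "\<exists>n\<ge>N. \<bar>x - real_of_rat (a n)\<bar> \<le> e * real_of_rat (detour n)"
    using n(2) by (intro exI[of _ n]) simp
qed

lemma strongly_dce_0_speedable: "strongly_dce_0_speedable x"
  by (rule strongly_dce_0_speedable_of_detours[OF a x(3) computable_rat_seq_detour detour_nonneg detour_le summable_detour
        frequently_good_detour])

end

section \<open>Closing the circle of implications\<close>

lemma not_random_imp_strongly_dce_0_speedable: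
  assumes x: "0 \<le> x" "x < 1" and dce: "dce_real x" and "\<not> martin_loef_random x"
  shows "strongly_dce_0_speedable x"
proof (cases "x \<in> \<rat>")
  case True
  \<comment> \<open>For rational \<open>x\<close>, \<open>speedable_via\<close> holds outright for
    any approximation.\<close>
  then show ?thesis
    using dce by (auto simp: strongly_dce_0_speedable_def speedable_via_def dce_real_def)
next
  case False
  obtain a where "dce_approximation a x" using dce unfolding dce_real_def by blast
  moreover obtain U where U: "martin_loef_test U" "\<And>i. binary_expansion x \<in> cylinders (U i)"
    using assms(4) unfolding martin_loef_random_def by blast
  moreover obtain g where "recursive_fn 2 g" "\<And>i \<sigma>. g [i, string_code \<sigma>] = of_bool (\<sigma> \<in> U i)"
    using U(1) unfolding martin_loef_test_def uniformly_computable_def by blast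
  ultimately interpret detours a x U g
    using x False by unfold_locales (auto simp: martin_loef_test_def)
  show ?thesis by (rule strongly_dce_0_speedable)
qed

theorem theorem2p1:
  fixes \<gamma> :: real
  assumes "\<gamma> \<in> {0<..<1}" and "dce_real \<gamma>"
  shows "(strongly_dce_0_speedable \<gamma> \<longleftrightarrow> dce_speedable \<gamma>) \<and>
         (dce_speedable \<gamma> \<longleftrightarrow> weakly_dce_speedable \<gamma>) \<and>
         (weakly_dce_speedable \<gamma> \<longleftrightarrow> \<not> martin_loef_random \<gamma>)"
  using assms strongly_imp_dce_speedable[of \<gamma>] dce_speedable_imp_weakly[of \<gamma>]
    weakly_dce_speedable_imp_not_random[of \<gamma>] not_random_imp_strongly_dce_0_speedable[of \<gamma>]
  by auto

end
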